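(* Let $S$ be a complete separable metric space, let $X=(X(t):t\ge 0)$ be an $S$-valued Markov process that is $v$-geometrically ergodic with limiting probability $\pi$, and let $f:S\to\mathbb{R}_+$ be bounded and continuous. Let $X(\infty)$ denote an $S$-valued random variable with distribution $\pi$, and suppose $\lambda^*:=\mathbb{E} f(X(\infty))>0$. For $\epsilon>0$ let $N_\epsilon$ be a doubly stochastic Poisson process with stochastic intensity $\lambda_\epsilon(t)=f(X(t/\epsilon))$, and let $N_0$ be a Poisson process with constant rate $\lambda^*$. Put $f_c(y)=f(y)-\mathbb{E} f(X(\infty))$, $$g(y)=\int_0^\infty\mathbb{E}_y f_c(X(s))\,ds,\qquad \sigma^2=2\,\mathbb{E}\big[f_c(X(\infty))g(X(\infty))\big].$$ Then for every $x\in S$, $t>0$ and integer $k\ge 0$, $$P_x(N_\epsilon(t)=k)=P(N_0(t)=k)+\epsilon\,P(N_0(t)=k)\left[\left(\frac{k}{\lambda^*t}-1\right)g(x)+\frac12\left(1-\frac{2k}{\lambda^*t}+\frac{k(k-1)}{(\lambda^*t)^2}\right)\sigma^2t\right]+o(\epsilon)$$ as $\epsilon\downarrow 0$.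
   Context: An $S$-valued (time-homogeneous) Markov process $X$ is $v$-geometrically ergodic if there exist a measurable function $v:S\to[1,\infty)$, a probability $\pi$ on $S$, $d<\infty$ and $\alpha>0$ such that $$\sup_{|h|\le v}\Big|\mathbb{E}_x h(X(t))-\int_S h(y)\,\pi(dy)\Big|\le d\,v(x)e^{-\alpha t}$$ for all $t\ge 0$ and $x\in S$, where the supremum is over measurable $h$ with $|h|\le v$ pointwise. Here $P_x(\cdot)=P(\,\cdot\mid X(0)=x)$ and $\mathbb{E}_x(\cdot)=\mathbb{E}(\,\cdot\mid X(0)=x)$. Under $v$-geometric ergodicity the integral defining $g$ converges absolutely and $|g|$ is bounded by a multiple of $v$. A doubly stochastic Poisson process with stochastic intensity $\lambda_\epsilon$ is a point process that, conditional on $X$, is a Poisson process with intensity function $s\mapsto\lambda_\epsilon(s)$. $o(\epsilon)$ denotes a function of $\epsilon$ with $o(\epsilon)/\epsilon\to 0$ as $\epsilon\downarrow 0$. *)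

theory Defs
  imports "HOL-Probability.Probability" "HOL-Library.Landau_Symbols"
begin

text \<open>All processes are indexed by \<open>real\<close>; only their values at times \<open>\<ge> 0\<close> are constrained.\<close>

definition process_sigma :: "'w measure \<Rightarrow> real set \<Rightarrow> (real \<Rightarrow> 'w \<Rightarrow> 's::topological_space) \<Rightarrow> 'w measure"
  where "process_sigma M T X =
    sigma (space M) {X u -` A \<inter> space M | u A. u \<in> T \<and> A \<in> sets borel}"

text \<open>
  The family \<open>P x\<close> plays the role of the conditional laws \<open>P( \<cdot> | X(0) = x)\<close>, so it is a probability
  kernel from the state space to the sample space \<open>M\<close>. Joint measurability in time and outcome
  (implied by right-continuity of paths) makes time integrals along paths meaningful.
\<close>
definition markov_process ::
  "'w measure \<Rightarrow> ('s::polish_space \<Rightarrow> 'w measure) \<Rightarrow> (real \<Rightarrow> 'w \<Rightarrow> 's) \<Rightarrow> bool"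
  where "markov_process M P X \<longleftrightarrow>
    P \<in> borel \<rightarrow>\<^sub>M prob_algebra M \<and>
    (\<lambda>(t, \<omega>). X t \<omega>) \<in> restrict_space borel {0..} \<Otimes>\<^sub>M M \<rightarrow>\<^sub>M borel \<and>
    (\<forall>x. AE \<omega> in P x. X 0 \<omega> = x) \<and>
    (\<forall>x. \<forall>s\<ge>0. \<forall>t\<ge>0. \<forall>A\<in>sets borel.
      AE \<omega> in P x.
        real_cond_exp (P x) (process_sigma M {0..s} X)
          (indicator {\<omega>' \<in> space M. X (s + t) \<omega>' \<in> A}) \<omega>
        = \<P>(\<omega>' in P (X s \<omega>). X t \<omega>' \<in> A))"

text \<open>
  The supremum is taken in \<open>ereal\<close>, where it always exists. Integrability of \<open>v\<close> is implicit in the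
  existence of the expectations of all \<open>h\<close> with \<open>|h| \<le> v\<close>; it is spelled out because the
  Bochner integral of a non-integrable function is \<open>0\<close>.
\<close>
definition geometrically_ergodic ::
  "('s::polish_space \<Rightarrow> 'w measure) \<Rightarrow> (real \<Rightarrow> 'w \<Rightarrow> 's) \<Rightarrow> ('s \<Rightarrow> real) \<Rightarrow> 's measure \<Rightarrow> bool"
  where "geometrically_ergodic P X v \<pi> \<longleftrightarrow>
    v \<in> borel_measurable borel \<and> (\<forall>y. 1 \<le> v y) \<and>
    prob_space \<pi> \<and> sets \<pi> = sets borel \<and>
    integrable \<pi> v \<and> (\<forall>x. \<forall>t\<ge>0. integrable (P x) (\<lambda>\<omega>. v (X t \<omega>))) \<and>
    (\<exists>d \<alpha>. 0 < \<alpha> \<and> (\<forall>x. \<forall>t\<ge>0.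
      (SUP h \<in> {h \<in> borel_measurable borel. \<forall>y. \<bar>h y\<bar> \<le> v y}.
          ereal \<bar>(\<integral>\<omega>. h (X t \<omega>) \<partial>P x) - (\<integral>y. h y \<partial>\<pi>)\<bar>)
        \<le> ereal (d * v x * exp (- \<alpha> * t))))"

definition counting_process :: "'w measure \<Rightarrow> (real \<Rightarrow> 'w \<Rightarrow> nat) \<Rightarrow> bool"
  where "counting_process M N \<longleftrightarrow>
    (\<forall>t\<ge>0. N t \<in> M \<rightarrow>\<^sub>M count_space UNIV) \<and>
    (\<forall>\<omega>\<in>space M. N 0 \<omega> = 0 \<and> mono_on {0..} (\<lambda>t. N t \<omega>) \<and>
      (\<forall>t\<ge>0. continuous (at_right t) (\<lambda>s. N s \<omega>)))"

text \<open>
  The library's \<open>poisson_pmf\<close> is specified for positive means only, but the integrated intensity of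
  a doubly stochastic process may vanish. Here mean \<open>0\<close> gives the point mass at \<open>0\<close>.
\<close>
definition poisson_prob :: "real \<Rightarrow> nat \<Rightarrow> real"
  where "poisson_prob \<mu> k = \<mu> ^ k / fact k * exp (- \<mu>)"

definition poisson_process :: "'w measure \<Rightarrow> real \<Rightarrow> (real \<Rightarrow> 'w \<Rightarrow> nat) \<Rightarrow> bool"
  where "poisson_process M r N \<longleftrightarrow>
    prob_space M \<and> counting_process M N \<and>
    (\<forall>n \<tau>. 0 \<le> \<tau> 0 \<and> mono \<tau> \<longrightarrow>
      prob_space.indep_vars M (\<lambda>_. count_space UNIV)
        (\<lambda>i \<omega>. N (\<tau> (Suc i)) \<omega> - N (\<tau> i) \<omega>) {..<n::nat}) \<and>
    (\<forall>s t k. 0 \<le> s \<and> s \<le> t \<longrightarrow>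
      \<P>(\<omega> in M. N t \<omega> - N s \<omega> = k) = poisson_prob (r * (t - s)) k)"

text \<open>
  Conditionally on the \<open>\<sigma>\<close>-algebra \<open>G\<close>, the increments of \<open>N\<close> over adjacent intervals are
  independent and Poisson distributed, with means the integrals of the intensity.
\<close>
definition doubly_stochastic_poisson_process ::
  "'w measure \<Rightarrow> 'w measure \<Rightarrow> (real \<Rightarrow> 'w \<Rightarrow> real) \<Rightarrow> (real \<Rightarrow> 'w \<Rightarrow> nat) \<Rightarrow> bool"
  where "doubly_stochastic_poisson_process M G l N \<longleftrightarrow>
    prob_space M \<and> counting_process M N \<and>
    (\<forall>n \<tau> k. 0 \<le> \<tau> 0 \<and> mono \<tau> \<longrightarrow>
      (AE \<omega> in M.
        real_cond_exp M G
          (indicator {\<omega>' \<in> space M. \<forall>i<n::nat. N (\<tau> (Suc i)) \<omega>' - N (\<tau> i) \<omega>' = k i}) \<omega>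
        = (\<Prod>i<n. poisson_prob (LBINT s:{\<tau> i..\<tau> (Suc i)}. l s \<omega>) (k i))))"

end

theory Submission
  imports Defs
begin

text \<open>
  Conditionally on \<open>X\<close> the number of points in \<open>[0, t]\<close> is Poisson distributed with mean
  \<open>A = \<integral>\<^sub>0\<^sup>t f (X (s / \<epsilon>)) ds = m + \<epsilon> Z\<close>, where \<open>m = \<lambda>\<^sup>* t\<close>, \<open>T = t / \<epsilon>\<close> and
  \<open>Z = \<integral>\<^sub>0\<^sup>T f\<^sub>c (X s) ds\<close> is a centred additive functional of \<open>X\<close> over a long time interval. The
  probability in question is therefore \<open>E \<phi>(m + \<epsilon> Z)\<close> with \<open>\<phi>(\<mu>) = \<mu>\<^sup>k e\<^sup>-\<^sup>\<mu> / k!\<close>, and a Taylor expansion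
  of \<open>\<phi>\<close> at \<open>m\<close> gives
  \<open>\<phi>(m) + \<phi>'(m) \<epsilon> E Z + \<phi>''(m) \<epsilon>\<^sup>2 E Z\<^sup>2 / 2\<close>. Since \<open>E Z \<rightarrow> g(x)\<close> and \<open>E Z\<^sup>2\<close> grows like
  \<open>\<sigma>\<^sup>2 T = \<sigma>\<^sup>2 t / \<epsilon>\<close>, both correction terms are of order \<open>\<epsilon>\<close>, and they are the two terms of the
  expansion (\<open>poisson_deriv_1\<close>, \<open>poisson_deriv_2\<close>).

  The Taylor remainder is at most a multiple of \<open>\<epsilon>\<^sup>3 E |Z|\<^sup>3\<close>. As \<open>|Z|\<close> may be as large as a multiple
  of \<open>T\<close>, the second moment alone only yields \<open>E |Z|\<^sup>3 = O(T\<^sup>2)\<close>, a remainder of the same order \<open>\<epsilon>\<close>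
  as the corrections. The proof therefore goes up to the fourth moment: \<open>E Z\<^sup>4 = O(T\<^sup>2)\<close> and the
  inequality \<open>2 |u|\<^sup>3 \<le> \<delta> u\<^sup>2 + u\<^sup>4 / \<delta>\<close> with \<open>u = \<epsilon> Z\<close> and \<open>\<delta> = \<epsilon>\<^sup>1\<^sup>/\<^sup>2\<close> make the remainder
  \<open>O(\<epsilon>\<^sup>3\<^sup>/\<^sup>2)\<close> (\<open>mixed_poisson_remainder\<close>).

  All moments come from one recursion. Integrating the pathwise identity
  \<open>(\<integral>\<^sub>s\<^sup>T \<phi>)\<^sup>n\<^sup>+\<^sup>1 = (n + 1) \<integral>\<^sub>s\<^sup>T \<phi>(r) (\<integral>\<^sub>r\<^sup>T \<phi>)\<^sup>n dr\<close> and applying the Markov property at time \<open>r\<close> gives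
  \<open>a\<^sub>n\<^sub>+\<^sub>1(T, x) = (n + 1) \<integral>\<^sub>0\<^sup>T E\<^sub>x [f\<^sub>c (X r) a\<^sub>n(T - r, X r)] dr\<close> for \<open>a\<^sub>n(T, x) = E\<^sub>x Z\<^sup>n\<close>
  (\<open>moment_Suc\<close>). The weight \<open>v\<close> need not be square integrable, so it is essential that \<open>v\<close> enters every
  bound linearly: each step of the recursion multiplies by the bounded function \<open>f\<^sub>c\<close> and then takes
  an expectation, and both operations preserve bounds by a multiple of \<open>v\<close>. Geometric ergodicity
  makes \<open>E\<^sub>x f\<^sub>c (X r)\<close> integrable in \<open>r\<close>, which is why every second step of the recursion gains
  no power of \<open>T\<close>.
\<close>

section \<open>Derivatives of Poisson probabilities in the mean\<close>

text \<open>
  The \<open>n\<close>-th derivative of the Poisson probability of \<open>k\<close> in the mean. Differentiation acts on these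
  probabilities as a backward difference in \<open>k\<close>; in this form all derivatives are evidently bounded.
\<close>
primrec poisson_deriv :: "nat \<Rightarrow> nat \<Rightarrow> real \<Rightarrow> real" where
  "poisson_deriv 0 k \<mu> = poisson_prob \<mu> k"
| "poisson_deriv (Suc n) k \<mu> = (case k of 0 \<Rightarrow> - poisson_deriv n 0 \<mu> | Suc j \<Rightarrow> poisson_deriv n j \<mu> - poisson_deriv n (Suc j) \<mu>)"

lemma has_derivative_poisson_deriv: "((\<lambda>\<mu>. poisson_deriv n k \<mu>) has_real_derivative poisson_deriv (Suc n) k \<mu>) (at \<mu>)"
proof (induction n arbitrary: k)
  case 0
  show ?case
  proof (cases k)
    case 0
    then show ?thesis
      by (auto simp: poisson_prob_def intro!: derivative_eq_intros)
  next
    case (Suc j)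
    have "((\<lambda>\<mu>. \<mu> ^ Suc j / fact (Suc j) * exp (- \<mu>)) has_real_derivative
       (real (Suc j) * \<mu> ^ j / fact (Suc j) * exp (- \<mu>) - \<mu> ^ Suc j / fact (Suc j) * exp (- \<mu>))) (at \<mu>)"
      by (rule derivative_eq_intros refl | simp)+
    moreover have "real (Suc j) * \<mu> ^ j / fact (Suc j) = \<mu> ^ j / fact j"
      by (simp add: divide_simps del: of_nat_Suc)
    ultimately show ?thesis using Suc by (simp add: poisson_prob_def)
  qed
next
  case (Suc n)
  show ?case
    by (cases k) (auto intro!: derivative_eq_intros Suc.IH simp del: poisson_deriv.simps(2)
        simp: poisson_deriv.simps(2)[of "n"] poisson_deriv.simps(2)[of "Suc n"])
qed

lemma poisson_prob_le_1:
  assumes "0 \<le> \<mu>" shows "0 \<le> poisson_prob \<mu> k" "poisson_prob \<mu> k \<le> 1"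
proof -
  show "0 \<le> poisson_prob \<mu> k" using assms by (simp add: poisson_prob_def)
  have "\<mu> ^ k / fact k \<le> exp \<mu>"
  proof -
    have s: "(\<lambda>n. \<mu> ^ n / fact n) sums exp \<mu>"
      using exp_converges[of \<mu>] by (simp add: divide_inverse mult.commute)
    have "sum (\<lambda>n. \<mu> ^ n / fact n) {k} \<le> (\<Sum>n. \<mu> ^ n / fact n)"
      using s assms by (intro sum_le_suminf) (auto simp: sums_iff)
    then show ?thesis using s by (simp add: sums_iff)
  qed
  then show "poisson_prob \<mu> k \<le> 1"
    by (simp add: poisson_prob_def exp_minus divide_simps mult.commute)
qed

text \<open>
  An \<open>n\<close>-fold difference has \<open>2\<^sup>n\<close> terms, each a signed probability.
\<close>
lemma poisson_deriv_bound: "0 \<le> \<mu> \<Longrightarrow> \<bar>poisson_deriv n k \<mu>\<bar> \<le> 2 ^ n"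
proof (induction n arbitrary: k)
  case 0
  then show ?case using poisson_prob_le_1[of \<mu> k] by simp
next
  case (Suc n)
  have "\<bar>poisson_deriv n j \<mu>\<bar> \<le> 2 ^ n" for j using Suc by blast
  from this[of 0] this[of k] this[of "k - 1"] show ?case by (cases k) auto
qed

lemma poisson_prob_Suc: "\<mu> > 0 \<Longrightarrow> poisson_prob \<mu> j = poisson_prob \<mu> (Suc j) * (real (Suc j) / \<mu>)"
  by (simp add: poisson_prob_def divide_simps del: of_nat_Suc)

lemma poisson_deriv_1:
  assumes "\<mu> > 0"
  shows "poisson_deriv 1 k \<mu> = poisson_prob \<mu> k * (real k / \<mu> - 1)"
proof (cases k)
  case (Suc j)
  then show ?thesis
    using poisson_prob_Suc[OF assms, of j] by (simp add: right_diff_distrib del: of_nat_Suc)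
qed simp

lemma poisson_deriv_2:
  assumes "\<mu> > 0"
  shows "poisson_deriv 2 k \<mu> = poisson_prob \<mu> k * (1 - 2 * real k / \<mu> + real k * (real k - 1) / \<mu>\<^sup>2)"
proof (cases k)
  case 0
  then show ?thesis by (simp add: numeral_2_eq_2)
next
  case (Suc j)
  define a where "a = real j"
  have ka: "a + 1 = real k" "a = real k - 1" using Suc by (auto simp: a_def)
  have "poisson_deriv 2 k \<mu> = poisson_deriv 1 j \<mu> - poisson_deriv 1 (Suc j) \<mu>" using Suc by (simp add: numeral_2_eq_2)
  also have "\<dots> = poisson_prob \<mu> k * ((a + 1) / \<mu> * (a / \<mu> - 1) - ((a + 1) / \<mu> - 1))"
    using assms unfolding poisson_deriv_1[OF assms] Suc poisson_prob_Suc[OF assms, of j] a_def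
    by (simp add: right_diff_distrib ac_simps)
  also have "(a + 1) / \<mu> * (a / \<mu> - 1) - ((a + 1) / \<mu> - 1) = 1 - 2 * (a + 1) / \<mu> + (a + 1) * a / \<mu>\<^sup>2"
    using assms by (simp add: field_simps power2_eq_square)
  finally show ?thesis unfolding ka(1) unfolding ka(2) .
qed

lemma poisson_prob_taylor:
  assumes "0 < m" "0 \<le> a"
  shows "\<bar>poisson_prob a k - (poisson_prob m k + poisson_deriv 1 k m * (a - m) + poisson_deriv 2 k m / 2 * (a - m)\<^sup>2)\<bar> \<le> 4 / 3 * \<bar>a - m\<bar> ^ 3"
proof (cases "a = m")
  case False
  from Taylor[of 3 "\<lambda>n. poisson_deriv n k" "\<lambda>\<mu>. poisson_prob \<mu> k" 0 "max a m" m a] assms False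
  obtain \<xi> where \<xi>: "if a < m then a < \<xi> \<and> \<xi> < m else m < \<xi> \<and> \<xi> < a" and
    eq: "poisson_prob a k = (\<Sum>j<3. (poisson_deriv j k m / fact j) * (a - m)^j) + (poisson_deriv 3 k \<xi> / fact 3) * (a - m)^3"
    using has_derivative_poisson_deriv by (auto simp del: poisson_deriv.simps simp: poisson_deriv.simps(1)[abs_def])
  have "0 \<le> \<xi>" using \<xi> assms by (auto split: if_splits)
  then have "\<bar>poisson_deriv 3 k \<xi>\<bar> \<le> 8" using poisson_deriv_bound[of \<xi> 3 k] by simp
  then have "\<bar>poisson_deriv 3 k \<xi>\<bar> * \<bar>a - m\<bar> ^ 3 \<le> 8 * \<bar>a - m\<bar> ^ 3" by (intro mult_right_mono) auto
  then have bound: "\<bar>poisson_deriv 3 k \<xi> * (a - m) ^ 3\<bar> \<le> 8 * \<bar>a - m\<bar> ^ 3"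
    by (simp only: abs_mult power_abs)
  have "(\<Sum>j<3. (poisson_deriv j k m / fact j) * (a - m)^j) =
      poisson_prob m k + poisson_deriv 1 k m * (a - m) + poisson_deriv 2 k m / 2 * (a - m)\<^sup>2"
    by (simp add: numeral_3_eq_3 numeral_2_eq_2 lessThan_Suc del: poisson_deriv.simps(2))
  then have "poisson_prob a k - (poisson_prob m k + poisson_deriv 1 k m * (a - m) + poisson_deriv 2 k m / 2 * (a - m)\<^sup>2)
      = (poisson_deriv 3 k \<xi> * (a - m) ^ 3) / 6"
    unfolding eq by (simp add: fact_numeral del: poisson_deriv.simps)
  then show ?thesis using bound by (simp only:)
next
  case True
  then show ?thesis by simp
qed

text \<open>
  An interpolation between the second and the fourth power. The free parameter \<open>\<delta>\<close> is later chosen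
  as a power of \<open>\<epsilon>\<close> that balances the two moments.
\<close>
lemma abs_power3_le:
  fixes u \<delta> :: real
  assumes "0 < \<delta>" shows "\<bar>u\<bar> ^ 3 \<le> (\<delta> * u\<^sup>2 + u ^ 4 / \<delta>) / 2"
proof -
  have "0 \<le> u\<^sup>2 * (\<bar>u\<bar> - \<delta>)\<^sup>2 / \<delta>" using assms by simp
  also have "\<dots> = \<delta> * u\<^sup>2 + u ^ 4 / \<delta> - 2 * \<bar>u\<bar> ^ 3"
    using assms by (auto simp: power2_eq_square power3_eq_cube power4_eq_xxxx field_simps abs_if)
  finally show ?thesis by simp
qed

lemma poisson_prob_measurable [measurable (raw)]:
  assumes [measurable]: "\<mu> \<in> borel_measurable K"
  shows "(\<lambda>p. poisson_prob (\<mu> p) k) \<in> borel_measurable K"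
  unfolding poisson_prob_def by measurable

section \<open>Lebesgue integrals over intervals\<close>

text \<open>
  Fubini's theorem in the form in which it is used below, where all integrands are bounded and live
  on sets of finite measure.
\<close>
lemma set_integral_swap:
  fixes F :: "'a \<Rightarrow> 'b \<Rightarrow> real"
  assumes "sigma_finite_measure \<mu>" "sigma_finite_measure \<nu>"
    and [measurable]: "A \<in> sets \<mu>" "B \<in> sets \<nu>" "(\<lambda>(x, y). F x y) \<in> borel_measurable (\<mu> \<Otimes>\<^sub>M \<nu>)"
    and fin: "emeasure \<mu> A < \<infinity>" "emeasure \<nu> B < \<infinity>"
    and bound: "\<And>x y. x \<in> A \<Longrightarrow> y \<in> B \<Longrightarrow> \<bar>F x y\<bar> \<le> C"
  shows "(LINT y:B|\<nu>. (LINT x:A|\<mu>. F x y)) = (LINT x:A|\<mu>. (LINT y:B|\<nu>. F x y))"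
proof -
  interpret \<nu>: sigma_finite_measure \<nu> by fact
  interpret pair_sigma_finite \<mu> \<nu> using assms by (simp add: pair_sigma_finite_def)
  have "integrable (\<mu> \<Otimes>\<^sub>M \<nu>) (\<lambda>(x, y). indicator B y * (indicator A x * F x y))"
  proof (rule integrableI_bounded_set[where A = "A \<times> B" and B = C])
    show "emeasure (\<mu> \<Otimes>\<^sub>M \<nu>) (A \<times> B) < \<infinity>"
      using fin by (simp add: \<nu>.emeasure_pair_measure_Times ennreal_mult_less_top)
    show "AE x\<in>A \<times> B in \<mu> \<Otimes>\<^sub>M \<nu>. norm (case x of (x, y) \<Rightarrow> indicator B y * (indicator A x * F x y)) \<le> C"
      using bound by (intro AE_I2) auto
  qed (auto intro!: AE_I2 simp: indicator_def split: if_splits)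
  from Fubini_integral[OF this]
  have "(LINT y:B|\<nu>. (LINT x:A|\<mu>. F x y)) = (\<integral>x. \<integral>y. indicator B y * (indicator A x * F x y) \<partial>\<nu> \<partial>\<mu>)"
    by (simp add: set_lebesgue_integral_def)
  also have "\<dots> = (\<integral>x. \<integral>y. indicator A x * (indicator B y * F x y) \<partial>\<nu> \<partial>\<mu>)"
    by (simp only: mult.left_commute)
  finally show ?thesis by (simp add: set_lebesgue_integral_def)
qed

lemma measurable_Icc_integral:
  fixes F :: "real \<Rightarrow> 'a \<Rightarrow> real"
  assumes [measurable]: "(\<lambda>(r, w). F r w) \<in> borel_measurable (borel \<Otimes>\<^sub>M M)"
    and [measurable]: "a \<in> borel_measurable M" "b \<in> borel_measurable M"
  shows "(\<lambda>w. LBINT r:{a w..b w}. F r w) \<in> borel_measurable M"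
proof -
  have "(\<lambda>w. LBINT r:{a w..b w}. F r w) = (\<lambda>w. \<integral>r. (if a w \<le> r \<and> r \<le> b w then F r w else 0) \<partial>lborel)"
    unfolding set_lebesgue_integral_def by (intro ext Bochner_Integration.integral_cong) auto
  also have "\<dots> \<in> borel_measurable M"
    by measurable
  finally show ?thesis .
qed

lemma set_integrable_Icc_bounded:
  fixes f :: "real \<Rightarrow> real"
  assumes "f \<in> borel_measurable borel" "\<And>r. r \<in> {a..b} \<Longrightarrow> \<bar>f r\<bar> \<le> C"
  shows "set_integrable lborel {a..b} f"
  unfolding set_integrable_def
  by (rule integrableI_bounded_set[where A = "{a..b}" and B = C]) (use assms in \<open>auto intro!: AE_I2 simp: emeasure_lborel_Icc_eq\<close>)

lemma set_integrable_const_Icc [simp]: "set_integrable lborel {a..b::real} (\<lambda>_. c :: real)"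
  by (rule set_integrable_Icc_bounded[where C = "\<bar>c\<bar>"]) auto

lemma abs_set_integral_le:
  fixes f g :: "'a \<Rightarrow> real"
  assumes "set_integrable \<mu> A g" "f \<in> borel_measurable \<mu>" "A \<in> sets \<mu>"
    "\<And>r. r \<in> A \<Longrightarrow> \<bar>f r\<bar> \<le> g r"
  shows "\<bar>LINT r:A|\<mu>. f r\<bar> \<le> (LINT r:A|\<mu>. g r)"
proof -
  have f: "set_integrable \<mu> A f"
    by (rule set_integrable_bound[OF assms(1)]) (use assms in \<open>force simp: set_borel_measurable_def\<close>)+
  then have "\<bar>LINT r:A|\<mu>. f r\<bar> \<le> (LINT r:A|\<mu>. \<bar>f r\<bar>)"
    using set_integral_norm_bound[OF f] by simp
  also have "\<dots> \<le> (LINT r:A|\<mu>. g r)"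
    by (rule set_integral_mono) (use assms f in \<open>auto intro: set_integrable_abs\<close>)
  finally show ?thesis .
qed

text \<open>
  For continuous \<open>\<phi>\<close> this integrates the derivative of \<open>(\<integral>\<^sub>r\<^sup>T \<phi>)\<^sup>n\<^sup>+\<^sup>1\<close> in \<open>r\<close>. Sample paths are only
  measurable, so the proof avoids differentiation: writing \<open>\<Phi>(r) = \<integral>\<^sub>r\<^sup>T \<phi>\<close>, the induction hypothesis
  turns \<open>J = \<integral> \<phi> \<Phi>\<^sup>n\<^sup>+\<^sup>1\<close> into a double integral over \<open>r \<le> u\<close>, and interchanging the order of
  integration produces \<open>J = \<Phi>(s)\<^sup>n\<^sup>+\<^sup>2 - (n + 1) J\<close>.
\<close>
lemma power_integral_eq_iterated:
  fixes \<phi> :: "real \<Rightarrow> real"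
  assumes [measurable]: "\<phi> \<in> borel_measurable borel" and bound: "\<And>r. \<bar>\<phi> r\<bar> \<le> C"
  shows "(LBINT u:{s..T}. \<phi> u) ^ Suc n = real (Suc n) * (LBINT r:{s..T}. \<phi> r * (LBINT u:{r..T}. \<phi> u) ^ n)"
proof -
  define \<Phi> where "\<Phi> = (\<lambda>r. LBINT u:{r..T}. \<phi> u)"
  have [measurable]: "\<Phi> \<in> borel_measurable borel"
    unfolding \<Phi>_def by (rule measurable_Icc_integral) auto
  have C: "0 \<le> C" using bound[of 0] by simp
  have int: "set_integrable lborel {a..b} \<phi>" for a b
    by (rule set_integrable_Icc_bounded) (auto intro: bound)
  define E where "E = C * \<bar>T - s\<bar>"
  have \<Phi>_bound: "\<bar>\<Phi> r\<bar> \<le> E" if "s \<le> r" for r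
  proof -
    have "\<bar>\<Phi> r\<bar> \<le> (LBINT u:{r..T}. C)"
      unfolding \<Phi>_def by (rule abs_set_integral_le) (auto intro: bound set_integrable_Icc_bounded[where C = C] simp: C)
    also have "\<dots> \<le> C * \<bar>T - s\<bar>"
      using C that by (subst set_integral_const) (auto simp: measure_def emeasure_lborel_Icc_eq mult.commute[of _ C] intro!: mult_left_mono)
    finally show ?thesis by (simp add: E_def)
  qed
  have "s \<le> s' \<Longrightarrow> \<Phi> s' ^ Suc n = real (Suc n) * (LBINT r:{s'..T}. \<phi> r * \<Phi> r ^ n)" for s'
  proof (induction n arbitrary: s')
    case 0
    then show ?case by (simp add: \<Phi>_def)
  next
    case (Suc n)
    define \<psi> where "\<psi> = (\<lambda>u. \<phi> u * \<Phi> u ^ n)"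
    have [measurable]: "\<psi> \<in> borel_measurable borel" unfolding \<psi>_def by measurable
    define D where "D = C * E ^ n"
    have D: "\<bar>\<psi> r\<bar> \<le> D" if "s \<le> r" for r
      unfolding \<psi>_def D_def abs_mult power_abs using that C
      by (intro mult_mono power_mono bound \<Phi>_bound) auto
    have int\<psi>: "set_integrable lborel {s'..T} \<psi>"
      by (rule set_integrable_Icc_bounded[where C = D]) (use Suc.prems in \<open>auto intro: D\<close>)
    have int\<psi>\<Phi>: "set_integrable lborel {s'..T} (\<lambda>u. \<psi> u * \<Phi> u)"
      by (rule set_integrable_Icc_bounded[where C = "D * E"])
        (use Suc.prems D[of s'] in \<open>auto simp: abs_mult intro!: mult_mono D \<Phi>_bound intro: order_trans[OF abs_ge_zero]\<close>)
    have split: "(LBINT r:{s'..T}. if r \<le> u then \<phi> r else 0) = \<Phi> s' - \<Phi> u" if u: "u \<in> {s'..T}" for u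
    proof -
      have "\<Phi> s' = (LBINT r:{s'..u} \<union> {u..T}. \<phi> r)"
        using u by (simp add: \<Phi>_def ivl_disj_un_two_touch)
      also have "\<dots> = (LBINT r:{s'..u}. \<phi> r) + \<Phi> u" unfolding \<Phi>_def
        by (rule set_integral_Un_AE) (use AE_lborel_singleton[of u] in \<open>auto simp: int elim!: eventually_mono\<close>)
      also have "(LBINT r:{s'..u}. \<phi> r) = (LBINT r:{s'..T}. if r \<le> u then \<phi> r else 0)"
        unfolding set_lebesgue_integral_def using u
        by (intro Bochner_Integration.integral_cong) (auto split: split_indicator)
      finally show ?thesis by simp
    qed
    define J where "J = (LBINT r:{s'..T}. \<phi> r * \<Phi> r ^ Suc n)"
    have "J = (LBINT r:{s'..T}. real (Suc n) * (LBINT u:{s'..T}. if r \<le> u then \<phi> r * \<psi> u else 0))"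
      unfolding J_def
    proof (rule set_lebesgue_integral_cong, simp, safe)
      fix r assume r: "r \<in> {s'..T}"
      have "\<phi> r * \<Phi> r ^ Suc n = \<phi> r * (real (Suc n) * (LBINT u:{r..T}. \<psi> u))"
        using Suc.IH[of r] r Suc.prems unfolding \<psi>_def by simp
      also have "\<dots> = real (Suc n) * (LBINT u:{r..T}. \<phi> r * \<psi> u)"
        by (simp add: set_integral_mult_right)
      also have "(LBINT u:{r..T}. \<phi> r * \<psi> u) = (LBINT u:{s'..T}. if r \<le> u then \<phi> r * \<psi> u else 0)"
        unfolding set_lebesgue_integral_def using r
        by (intro Bochner_Integration.integral_cong) (auto split: split_indicator)
      finally show "\<phi> r * \<Phi> r ^ Suc n = real (Suc n) * (LBINT u:{s'..T}. if r \<le> u then \<phi> r * \<psi> u else 0)" .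
    qed
    also have "\<dots> = real (Suc n) * (LBINT r:{s'..T}. (LBINT u:{s'..T}. if r \<le> u then \<phi> r * \<psi> u else 0))"
      by (simp add: set_integral_mult_right)
    also have "(LBINT r:{s'..T}. (LBINT u:{s'..T}. if r \<le> u then \<phi> r * \<psi> u else 0))
        = (LBINT u:{s'..T}. (LBINT r:{s'..T}. if r \<le> u then \<phi> r * \<psi> u else 0))"
      by (rule set_integral_swap[where C = "C * D", symmetric])
        (use C D[of s'] Suc.prems in \<open>auto simp: abs_mult emeasure_lborel_Icc_eq lborel.sigma_finite_measure_axioms intro!: mult_mono bound D\<close>)
    also have "\<dots> = (LBINT u:{s'..T}. \<Phi> s' * \<psi> u - \<psi> u * \<Phi> u)"
    proof (rule set_lebesgue_integral_cong, simp, safe)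
      fix u assume u: "u \<in> {s'..T}"
      have "(LBINT r:{s'..T}. if r \<le> u then \<phi> r * \<psi> u else 0) = (LBINT r:{s'..T}. (if r \<le> u then \<phi> r else 0) * \<psi> u)"
        by (intro set_lebesgue_integral_cong) auto
      also have "\<dots> = (\<Phi> s' - \<Phi> u) * \<psi> u"
        using split[OF u] by (simp only: set_integral_mult_left)
      finally show "(LBINT r:{s'..T}. if r \<le> u then \<phi> r * \<psi> u else 0) = \<Phi> s' * \<psi> u - \<psi> u * \<Phi> u"
        by (simp add: algebra_simps)
    qed
    also have "\<dots> = \<Phi> s' * (LBINT u:{s'..T}. \<psi> u) - (LBINT u:{s'..T}. \<psi> u * \<Phi> u)"
      using int\<psi> int\<psi>\<Phi> by (simp add: set_integral_diff)
    also have "(LBINT u:{s'..T}. \<psi> u * \<Phi> u) = J"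
      unfolding J_def \<psi>_def by (intro set_lebesgue_integral_cong) auto
    finally have "J = \<Phi> s' * (real (Suc n) * (LBINT u:{s'..T}. \<psi> u)) - real (Suc n) * J"
      by (simp add: algebra_simps)
    also have "real (Suc n) * (LBINT u:{s'..T}. \<psi> u) = \<Phi> s' ^ Suc n"
      using Suc.IH[OF Suc.prems] unfolding \<psi>_def by simp
    finally show ?case unfolding J_def[symmetric] by (simp add: algebra_simps)
  qed
  from this[of s] show ?thesis unfolding \<Phi>_def by simp
qed

lemma set_integral_over_space: "(LINT x:space \<mu>|\<mu>. f x) = (\<integral>x. f x \<partial>\<mu>)" for f :: "'a \<Rightarrow> real"
  unfolding set_lebesgue_integral_def by (intro Bochner_Integration.integral_cong) auto

lemma set_integral_Icc_shift:
  fixes f :: "real \<Rightarrow> real"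
  shows "(LBINT r:{s..T}. f (r - s)) = (LBINT r:{0..T - s}. f r)"
proof -
  have "(LBINT r:{s..T}. f (r - s)) = (\<integral>r. indicator {s..T} (s + 1 * r) *\<^sub>R f (s + 1 * r - s) \<partial>lborel)"
    unfolding set_lebesgue_integral_def
    by (subst lborel_integral_real_affine[where c = 1 and t = s]) auto
  also have "\<dots> = (LBINT r:{0..T - s}. f r)"
    unfolding set_lebesgue_integral_def
    by (intro Bochner_Integration.integral_cong) (auto split: split_indicator)
  finally show ?thesis .
qed

lemma set_integral_Icc_scale:
  fixes f :: "real \<Rightarrow> real"
  assumes "0 < \<epsilon>"
  shows "(LBINT s:{0..t}. f (s / \<epsilon>)) = \<epsilon> * (LBINT r:{0..t / \<epsilon>}. f r)"
proof -
  have "(LBINT s:{0..t}. f (s / \<epsilon>)) = \<epsilon> * (\<integral>r. indicator {0..t} (0 + \<epsilon> * r) *\<^sub>R f ((0 + \<epsilon> * r) / \<epsilon>) \<partial>lborel)"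
    unfolding set_lebesgue_integral_def using assms
    by (subst lborel_integral_real_affine[where c = \<epsilon> and t = 0]) auto
  also have "(\<integral>r. indicator {0..t} (0 + \<epsilon> * r) *\<^sub>R f ((0 + \<epsilon> * r) / \<epsilon>) \<partial>lborel) = (LBINT r:{0..t / \<epsilon>}. f r)"
    unfolding set_lebesgue_integral_def using assms
    by (intro Bochner_Integration.integral_cong) (auto simp: field_simps zero_le_mult_iff split: split_indicator)
  finally show ?thesis .
qed

lemma exp_decay_integral:
  fixes \<alpha> a :: real
  assumes "0 < \<alpha>"
  shows "set_integrable lborel {a..} (\<lambda>s. exp (- \<alpha> * s))"
    and "(LBINT s:{a..}. exp (- \<alpha> * s)) = exp (- \<alpha> * a) / \<alpha>"
proof -
  have "((\<lambda>s. - exp (- \<alpha> * s) / \<alpha>) \<longlongrightarrow> - 0 / \<alpha>) at_top"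
    using assms by (intro tendsto_intros filterlim_compose[OF exp_at_bot] filterlim_tendsto_neg_mult_at_bot[OF tendsto_const _ filterlim_ident]) auto
  then have *: "(\<integral>\<^sup>+ s. ennreal (exp (- \<alpha> * s)) * indicator {a..} s \<partial>lborel) = ennreal (0 - (- exp (- \<alpha> * a) / \<alpha>))"
    using assms by (intro nn_integral_FTC_atLeast) (auto intro!: derivative_eq_intros)
  have "has_bochner_integral lborel (\<lambda>s. indicator {a..} s *\<^sub>R exp (- \<alpha> * s)) (exp (- \<alpha> * a) / \<alpha>)"
    using assms * by (intro has_bochner_integral_nn_integral) (auto simp: ennreal_mult ennreal_indicator mult.commute)
  then show "set_integrable lborel {a..} (\<lambda>s. exp (- \<alpha> * s))"
    "(LBINT s:{a..}. exp (- \<alpha> * s)) = exp (- \<alpha> * a) / \<alpha>"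
    by (auto simp: set_integrable_def set_lebesgue_integral_def has_bochner_integral_iff)
qed

lemma exp_decay_integral_Icc:
  fixes \<alpha> T :: real
  assumes "0 < \<alpha>"
  shows "set_integrable lborel {0..T} (\<lambda>s. exp (- \<alpha> * s))"
    and "(LBINT s:{0..T}. exp (- \<alpha> * s)) \<le> 1 / \<alpha>"
    and "set_integrable lborel {0..T} (\<lambda>s. exp (- \<alpha> * (T - s)))"
    and "(LBINT s:{0..T}. exp (- \<alpha> * (T - s))) \<le> 1 / \<alpha>"
proof -
  show int: "set_integrable lborel {0..T} (\<lambda>s. exp (- \<alpha> * s))"
    by (intro borel_integrable_atLeastAtMost' continuous_intros)
  have "(LBINT s:{0..T}. exp (- \<alpha> * s)) \<le> (LBINT s:{0..}. exp (- \<alpha> * s))"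
    unfolding set_lebesgue_integral_def
    using int exp_decay_integral(1)[OF assms, of 0]
    by (intro integral_mono) (auto simp: set_integrable_def split: split_indicator)
  then show le: "(LBINT s:{0..T}. exp (- \<alpha> * s)) \<le> 1 / \<alpha>"
    using exp_decay_integral(2)[OF assms, of 0] by simp
  show "set_integrable lborel {0..T} (\<lambda>s. exp (- \<alpha> * (T - s)))"
    by (intro borel_integrable_atLeastAtMost' continuous_intros)
  have "(LBINT s:{0..T}. exp (- \<alpha> * s)) = (LBINT s:{0..T}. exp (- \<alpha> * (T - s)))"
    unfolding set_lebesgue_integral_def
    by (subst lborel_integral_real_affine[where c = "- 1" and t = T])
      (auto intro!: Bochner_Integration.integral_cong split: split_indicator)
  then show "(LBINT s:{0..T}. exp (- \<alpha> * (T - s))) \<le> 1 / \<alpha>" using le by simp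
qed

section \<open>The Markov property\<close>

lemma borel_measurable_kernel_integral:
  fixes F :: "'a \<Rightarrow> 'b \<Rightarrow> real"
  assumes [measurable]: "(\<lambda>(p, w). F p w) \<in> borel_measurable (K \<Otimes>\<^sub>M M)"
    and [measurable]: "L \<in> K \<rightarrow>\<^sub>M subprob_algebra M"
  shows "(\<lambda>p. \<integral>w. F p w \<partial>L p) \<in> borel_measurable K"
proof -
  note measurable_distr2[measurable]
  have "(\<lambda>p. integral\<^sup>L (distr (L p) (K \<Otimes>\<^sub>M M) (\<lambda>w. (p, w))) (\<lambda>(p, w). F p w)) \<in> borel_measurable K"
    by measurable
  then show ?thesis
    by (rule measurable_cong[THEN iffD1, rotated]) (simp add: integral_distr)
qed

locale markov =
  fixes M :: "'w measure" and P :: "'s::polish_space \<Rightarrow> 'w measure" and X :: "real \<Rightarrow> 'w \<Rightarrow> 's"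
  assumes markov: "markov_process M P X"
begin

text \<open>
  Clamping times to the half line makes the process measurable on all of \<open>real\<close>, so that
  measurability proofs need no case distinction on the sign of the time.
\<close>
definition Xp :: "real \<Rightarrow> 'w \<Rightarrow> 's" where "Xp t = X (max 0 t)"

abbreviation \<F> :: "real \<Rightarrow> 'w measure" where "\<F> s \<equiv> process_sigma M {0..s} X"

lemma Xp_nonneg: "0 \<le> t \<Longrightarrow> Xp t = X t"
  by (simp add: Xp_def)

lemma P_measurable [measurable]: "P \<in> borel \<rightarrow>\<^sub>M subprob_algebra M"
  using markov by (auto simp: markov_process_def intro: measurable_prob_algebraD)

lemma P_in: "P x \<in> space (prob_algebra M)"
  using markov by (auto simp: markov_process_def intro: measurable_space[of P borel])

lemma sets_P [measurable_cong, simp]: "sets (P x) = sets M"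
  using P_in by (simp add: space_prob_algebra)

lemma space_P [simp]: "space (P x) = space M"
  by (rule sets_eq_imp_space_eq) simp

lemma prob_space_P: "prob_space (P x)"
  using P_in by (simp add: space_prob_algebra)

lemma emeasure_P_space [simp]: "emeasure (P x) (space M) = 1"
  using prob_space.emeasure_space_1[OF prob_space_P[of x]] by simp

lemma Xp_measurable_compose [measurable (raw)]:
  assumes [measurable]: "\<tau> \<in> borel_measurable K" "w \<in> K \<rightarrow>\<^sub>M M"
  shows "(\<lambda>p. Xp (\<tau> p) (w p)) \<in> K \<rightarrow>\<^sub>M borel"
proof -
  have "(\<lambda>p. (max 0 (\<tau> p), w p)) \<in> K \<rightarrow>\<^sub>M restrict_space borel {0..} \<Otimes>\<^sub>M M"
    by (intro measurable_Pair measurable_restrict_space2) auto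
  from measurable_compose[OF this, of "\<lambda>(t, \<omega>). X t \<omega>" borel] show ?thesis
    using markov by (simp add: markov_process_def Xp_def)
qed

lemma integral_P_measurable:
  fixes F :: "'a \<Rightarrow> 'w \<Rightarrow> real"
  assumes [measurable]: "(\<lambda>(p, w). F p w) \<in> borel_measurable (K \<Otimes>\<^sub>M M)"
    and [measurable]: "y \<in> K \<rightarrow>\<^sub>M borel"
  shows "(\<lambda>p. \<integral>w. F p w \<partial>P (y p)) \<in> borel_measurable K"
  by (rule borel_measurable_kernel_integral[where M = M]) measurable

lemma sets_process_sigma:
  "sets (process_sigma M T X) = sigma_sets (space M) {X u -` A \<inter> space M | u A. u \<in> T \<and> A \<in> sets borel}"
  unfolding process_sigma_def by (rule sets_measure_of) auto

lemma space_process_sigma [simp]: "space (process_sigma M T X) = space M"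
  unfolding process_sigma_def by (rule space_measure_of) auto

lemma subalgebra_process_sigma:
  assumes "T \<subseteq> {0..}" shows "subalgebra (P x) (process_sigma M T X)"
proof -
  have "X u -` A \<inter> space M \<in> sets M" if "u \<in> T" "A \<in> sets borel" for u A
  proof -
    have "Xp u \<in> M \<rightarrow>\<^sub>M borel" by measurable
    moreover have "Xp u = X u" using that assms by (intro Xp_nonneg) auto
    ultimately show ?thesis using measurable_sets[of "X u" M borel A] that by simp
  qed
  then show ?thesis
    unfolding subalgebra_def sets_process_sigma by (auto intro!: sets.sigma_sets_subset)
qed

lemma process_sigma_measurable_mono:
  assumes "Y \<in> borel_measurable (process_sigma M T X)" "T \<subseteq> T'"
  shows "Y \<in> borel_measurable (process_sigma M T' X)"
proof -
  have "sets (process_sigma M T X) \<subseteq> sets (process_sigma M T' X)"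
    unfolding sets_process_sigma using assms(2) by (intro sigma_sets_mono') auto
  then show ?thesis using assms(1) by (auto simp: measurable_def)
qed

lemma process_sigma_measurable_M:
  assumes "Y \<in> borel_measurable (process_sigma M T X)" "T \<subseteq> {0..}"
  shows "Y \<in> borel_measurable M"
  using measurable_from_subalg[OF subalgebra_process_sigma[OF assms(2)] assms(1), of undefined]
  by simp

lemma X_measurable_process_sigma:
  assumes "u \<in> T" shows "X u \<in> process_sigma M T X \<rightarrow>\<^sub>M borel"
proof (rule measurableI)
  fix A :: "'s set" assume "A \<in> sets borel"
  then show "X u -` A \<inter> space (process_sigma M T X) \<in> sets (process_sigma M T X)"
    unfolding sets_process_sigma space_process_sigma using assms by blast
qed auto

lemma cond_exp_subalgebra:
  assumes "T \<subseteq> {0..}" shows "finite_measure_subalgebra (P x) (process_sigma M T X)"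
  using prob_space_P[of x] subalgebra_process_sigma[OF assms, of x]
  by (simp add: finite_measure_subalgebra_def finite_measure_subalgebra_axioms_def prob_space.finite_measure)

lemma integrable_P_bounded:
  fixes Z :: "'w \<Rightarrow> real"
  assumes "Z \<in> borel_measurable M" "\<And>\<omega>. \<omega> \<in> space M \<Longrightarrow> \<bar>Z \<omega>\<bar> \<le> C"
  shows "integrable (P x) Z"
proof -
  interpret prob_space "P x" by (rule prob_space_P)
  show ?thesis by (rule integrable_const_bound[where B = C]) (use assms in auto)
qed

lemma abs_integral_P_le:
  fixes Z :: "'w \<Rightarrow> real"
  assumes [measurable]: "Z \<in> borel_measurable M" and "\<And>\<omega>. \<omega> \<in> space M \<Longrightarrow> \<bar>Z \<omega>\<bar> \<le> C"
  shows "\<bar>\<integral>\<omega>. Z \<omega> \<partial>P x\<bar> \<le> C"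
proof -
  interpret prob_space "P x" by (rule prob_space_P)
  have "\<bar>expectation Z\<bar> \<le> expectation (\<lambda>\<omega>. \<bar>Z \<omega>\<bar>)" by (rule integral_abs_bound)
  also have "\<dots> \<le> C"
    using integrable_P_bounded[OF assms] by (intro integral_le_const) (auto simp: assms)
  finally show ?thesis .
qed

text \<open>
  The Markov property is assumed for the conditional probabilities of events \<open>X (s + t) \<in> A\<close>. Tested
  against a function of the past, it becomes an identity of expectations that composes under
  time integrals.
\<close>
lemma markov_indicator:
  assumes s: "0 \<le> s" "0 \<le> t" and Y: "Y \<in> borel_measurable (\<F> s)" and C: "\<And>\<omega>. \<bar>Y \<omega>\<bar> \<le> C" and A: "A \<in> sets borel"
  shows "(\<integral>\<omega>. Y \<omega> * indicator A (Xp (s + t) \<omega>) \<partial>P x) = (\<integral>\<omega>. Y \<omega> * \<P>(\<omega>' in P (Xp s \<omega>). Xp t \<omega>' \<in> A) \<partial>P x)"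
proof -
  interpret fs: finite_measure_subalgebra "P x" "\<F> s" by (rule cond_exp_subalgebra) auto
  note [measurable] = A
  have [measurable]: "Y \<in> borel_measurable M"
    by (rule process_sigma_measurable_M[OF Y]) auto
  define I where "I = (indicator {\<omega> \<in> space M. Xp (s + t) \<omega> \<in> A} :: 'w \<Rightarrow> real)"
  have [measurable]: "I \<in> borel_measurable M" unfolding I_def by measurable
  have [measurable]: "(\<lambda>\<omega>. \<P>(\<omega>' in P (Xp s \<omega>). Xp t \<omega>' \<in> A)) \<in> borel_measurable M"
    by (rule measurable_compose[OF _ measure_measurable_subprob_algebra2[where M = borel and N = M, OF _ P_measurable]]) auto
  have "(\<integral>\<omega>. Y \<omega> * indicator A (Xp (s + t) \<omega>) \<partial>P x) = (\<integral>\<omega>. Y \<omega> * I \<omega> \<partial>P x)"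
    by (intro Bochner_Integration.integral_cong) (auto simp: I_def split: split_indicator)
  also have "\<dots> = (\<integral>\<omega>. Y \<omega> * real_cond_exp (P x) (\<F> s) I \<omega> \<partial>P x)"
  proof (rule fs.real_cond_exp_intg(2)[symmetric])
    have "0 \<le> C" using C[of undefined] by simp
    then show "integrable (P x) (\<lambda>\<omega>. Y \<omega> * I \<omega>)"
      by (intro integrable_P_bounded[where C = C]) (auto simp: I_def C split: split_indicator)
  qed (use Y in auto)
  also have "\<dots> = (\<integral>\<omega>. Y \<omega> * \<P>(\<omega>' in P (Xp s \<omega>). Xp t \<omega>' \<in> A) \<partial>P x)"
  proof (rule integral_cong_AE)
    have "AE \<omega> in P x. real_cond_exp (P x) (\<F> s) I \<omega> = \<P>(\<omega>' in P (Xp s \<omega>). Xp t \<omega>' \<in> A)"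
      using markov s A unfolding markov_process_def I_def by (simp add: Xp_nonneg)
    then show "AE \<omega> in P x. Y \<omega> * real_cond_exp (P x) (\<F> s) I \<omega> = Y \<omega> * \<P>(\<omega>' in P (Xp s \<omega>). Xp t \<omega>' \<in> A)"
      by eventually_elim simp
  qed (auto simp: measurable_from_subalg[OF fs.subalg])
  finally show ?thesis .
qed

lemma markov_nn_integral:
  assumes s: "0 \<le> s" "0 \<le> t" and Y: "Y \<in> borel_measurable (\<F> s)" and C: "\<And>\<omega>. 0 \<le> Y \<omega>" "\<And>\<omega>. Y \<omega> \<le> C"
    and h: "h \<in> borel_measurable borel"
  shows "(\<integral>\<^sup>+\<omega>. ennreal (Y \<omega>) * h (Xp (s + t) \<omega>) \<partial>P x)
    = (\<integral>\<^sup>+\<omega>. ennreal (Y \<omega>) * (\<integral>\<^sup>+\<omega>'. h (Xp t \<omega>') \<partial>P (Xp s \<omega>)) \<partial>P x)"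
proof -
  have [measurable]: "Y \<in> borel_measurable M"
    by (rule process_sigma_measurable_M[OF Y]) auto
  have meas: "(\<lambda>\<omega>. \<integral>\<^sup>+\<omega>'. k (Xp t \<omega>') \<partial>P (Xp s \<omega>)) \<in> borel_measurable M"
    if [measurable]: "k \<in> borel_measurable borel" for k
    by (rule nn_integral_measurable_subprob_algebra2[where N = M]) measurable
  show ?thesis using h
  proof (induction h rule: borel_measurable_induct)
    case (cong f g)
    then show ?case by (simp cong: nn_integral_cong)
  next
    case (set A)
    note [measurable] = set
    have bY: "\<bar>Y \<omega>\<bar> \<le> C" for \<omega> using C[of \<omega>] by simp
    have "0 \<le> C" using C[of undefined] by simp
    have pr: "(\<integral>\<^sup>+\<omega>'. indicator A (Xp t \<omega>') \<partial>P y) = ennreal (\<P>(\<omega>' in P y. Xp t \<omega>' \<in> A))" for y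
    proof -
      interpret prob_space "P y" by (rule prob_space_P)
      have "(\<integral>\<^sup>+\<omega>'. indicator A (Xp t \<omega>') \<partial>P y) = (\<integral>\<^sup>+\<omega>'. indicator {\<omega>' \<in> space M. Xp t \<omega>' \<in> A} \<omega>' \<partial>P y)"
        by (intro nn_integral_cong) (auto split: split_indicator)
      then show ?thesis by (simp add: emeasure_eq_measure)
    qed
    have [measurable]: "(\<lambda>\<omega>. \<P>(\<omega>' in P (Xp s \<omega>). Xp t \<omega>' \<in> A)) \<in> borel_measurable M"
      by (rule measurable_compose[OF _ measure_measurable_subprob_algebra2[where M = borel and N = M, OF _ P_measurable]]) auto
    have "(\<integral>\<^sup>+\<omega>. ennreal (Y \<omega>) * indicator A (Xp (s + t) \<omega>) \<partial>P x)
        = (\<integral>\<^sup>+\<omega>. ennreal (Y \<omega> * indicator A (Xp (s + t) \<omega>)) \<partial>P x)"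
      by (intro nn_integral_cong) (auto split: split_indicator)
    also have "\<dots> = ennreal (\<integral>\<omega>. Y \<omega> * indicator A (Xp (s + t) \<omega>) \<partial>P x)"
      by (rule nn_integral_eq_integral)
        (use C \<open>0 \<le> C\<close> in \<open>auto intro!: integrable_P_bounded[where C = C] split: split_indicator\<close>)
    also have "\<dots> = ennreal (\<integral>\<omega>. Y \<omega> * \<P>(\<omega>' in P (Xp s \<omega>). Xp t \<omega>' \<in> A) \<partial>P x)"
      by (simp only: markov_indicator[OF s Y bY set])
    also have "\<dots> = (\<integral>\<^sup>+\<omega>. ennreal (Y \<omega> * \<P>(\<omega>' in P (Xp s \<omega>). Xp t \<omega>' \<in> A)) \<partial>P x)"
      by (rule nn_integral_eq_integral[symmetric])
        (use C \<open>0 \<le> C\<close> prob_space.prob_le_1[OF prob_space_P] in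
          \<open>auto intro!: integrable_P_bounded[where C = "C * 1"] mult_mono simp: abs_mult simp del: mult_1_right\<close>)
    finally show ?case by (simp add: pr C ennreal_mult)
  next
    case (mult u c)
    note [measurable] = mult(2)
    show ?case
      by (simp add: nn_integral_cmult meas mult.left_commute[of _ c] mult.IH)
  next
    case (add u v)
    note [measurable] = add(1,4)
    show ?case
      using add by (simp add: nn_integral_add meas distrib_left)
  next
    case (seq U)
    note [measurable] = seq(1)
    have inc: "incseq (\<lambda>i y. U i y)" by fact
    have "(\<integral>\<^sup>+\<omega>. ennreal (Y \<omega>) * (SUP i. U i) (Xp (s + t) \<omega>) \<partial>P x)
       = (\<integral>\<^sup>+\<omega>. (SUP i. ennreal (Y \<omega>) * U i (Xp (s + t) \<omega>)) \<partial>P x)"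
      by (simp add: SUP_mult_left_ennreal image_comp)
    also have "\<dots> = (SUP i. \<integral>\<^sup>+\<omega>. ennreal (Y \<omega>) * U i (Xp (s + t) \<omega>) \<partial>P x)"
      using inc by (intro nn_integral_monotone_convergence_SUP) (auto simp: incseq_def le_fun_def intro!: mult_left_mono)
    also have "\<dots> = (SUP i. \<integral>\<^sup>+\<omega>. ennreal (Y \<omega>) * (\<integral>\<^sup>+\<omega>'. U i (Xp t \<omega>') \<partial>P (Xp s \<omega>)) \<partial>P x)"
      by (simp only: seq)
    also have "\<dots> = (\<integral>\<^sup>+\<omega>. (SUP i. ennreal (Y \<omega>) * (\<integral>\<^sup>+\<omega>'. U i (Xp t \<omega>') \<partial>P (Xp s \<omega>))) \<partial>P x)"
      using inc by (intro nn_integral_monotone_convergence_SUP[symmetric])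
        (auto simp: incseq_def le_fun_def meas intro!: mult_left_mono nn_integral_mono)
    also have "\<dots> = (\<integral>\<^sup>+\<omega>. ennreal (Y \<omega>) * (SUP i. (\<integral>\<^sup>+\<omega>'. U i (Xp t \<omega>') \<partial>P (Xp s \<omega>))) \<partial>P x)"
      by (simp add: SUP_mult_left_ennreal)
    also have "\<dots> = (\<integral>\<^sup>+\<omega>. ennreal (Y \<omega>) * (\<integral>\<^sup>+\<omega>'. (SUP i. U i (Xp t \<omega>')) \<partial>P (Xp s \<omega>)) \<partial>P x)"
      using inc by (subst nn_integral_monotone_convergence_SUP) (auto simp: incseq_def le_fun_def)
    finally show ?case by (simp add: image_comp)
  qed
qed

text \<open>
  Shifting \<open>Y\<close> and \<open>h\<close> by their bounds reduces this to nonnegative functions.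
\<close>
lemma markov_integral:
  fixes Y :: "'w \<Rightarrow> real" and h :: "'s \<Rightarrow> real"
  assumes s: "0 \<le> s" "0 \<le> t" and Y: "Y \<in> borel_measurable (\<F> s)" and C: "\<And>\<omega>. \<bar>Y \<omega>\<bar> \<le> C"
    and h[measurable]: "h \<in> borel_measurable borel" and D: "\<And>y. \<bar>h y\<bar> \<le> D"
  shows "(\<integral>\<omega>. Y \<omega> * h (Xp (s + t) \<omega>) \<partial>P x) = (\<integral>\<omega>. Y \<omega> * (\<integral>\<omega>'. h (Xp t \<omega>') \<partial>P (Xp s \<omega>)) \<partial>P x)"
proof -
  have Y'[measurable]: "Y \<in> borel_measurable M"
    by (rule process_sigma_measurable_M[OF Y]) auto
  have CD: "0 \<le> C" "0 \<le> D" using order_trans[OF abs_ge_zero C] order_trans[OF abs_ge_zero D] by auto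
  have meas: "(\<lambda>\<omega>. \<integral>\<omega>'. k (Xp t \<omega>') \<partial>P (Xp s \<omega>)) \<in> borel_measurable M"
    if [measurable]: "k \<in> borel_measurable borel" for k :: "'s \<Rightarrow> real"
    by (rule integral_P_measurable) measurable
  have pos: "(\<integral>\<omega>. Z \<omega> * k (Xp (s + t) \<omega>) \<partial>P x) = (\<integral>\<omega>. Z \<omega> * (\<integral>\<omega>'. k (Xp t \<omega>') \<partial>P (Xp s \<omega>)) \<partial>P x)"
    if Z: "Z \<in> borel_measurable (\<F> s)" "\<And>\<omega>. 0 \<le> Z \<omega>" "\<And>\<omega>. Z \<omega> \<le> E"
      and k[measurable]: "k \<in> borel_measurable borel" and k_bound: "\<And>y. 0 \<le> k y" "\<And>y. k y \<le> F" for Z E F and k :: "'s \<Rightarrow> real"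
  proof -
    have [measurable]: "Z \<in> borel_measurable M"
      by (rule process_sigma_measurable_M[OF Z(1)]) auto
    have *: "ennreal (\<integral>\<omega>'. k (Xp t \<omega>') \<partial>P y) = (\<integral>\<^sup>+\<omega>'. ennreal (k (Xp t \<omega>')) \<partial>P y)" for y
      by (rule nn_integral_eq_integral[symmetric]) (auto simp: k_bound intro!: integrable_P_bounded[where C = F])
    have "(\<integral>\<omega>. Z \<omega> * k (Xp (s + t) \<omega>) \<partial>P x) = enn2real (\<integral>\<^sup>+\<omega>. ennreal (Z \<omega>) * ennreal (k (Xp (s + t) \<omega>)) \<partial>P x)"
      by (subst integral_eq_nn_integral) (auto simp: Z k_bound ennreal_mult)
    also have "\<dots> = enn2real (\<integral>\<^sup>+\<omega>. ennreal (Z \<omega>) * ennreal (\<integral>\<omega>'. k (Xp t \<omega>') \<partial>P (Xp s \<omega>)) \<partial>P x)"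
      unfolding * by (subst markov_nn_integral[OF s Z]) auto
    also have "\<dots> = (\<integral>\<omega>. Z \<omega> * (\<integral>\<omega>'. k (Xp t \<omega>') \<partial>P (Xp s \<omega>)) \<partial>P x)"
      by (subst integral_eq_nn_integral) (auto simp: Z k_bound ennreal_mult integral_nonneg_AE meas)
    finally show ?thesis .
  qed
  have int: "integrable (P x) (\<lambda>\<omega>. Z \<omega> * h (Xp (s + t) \<omega>))"
       "integrable (P x) (\<lambda>\<omega>. Z \<omega> * (\<integral>\<omega>'. h (Xp t \<omega>') \<partial>P (Xp s \<omega>)))"
       "integrable (P x) Z"
    if [measurable]: "Z \<in> borel_measurable M" and Z: "\<And>\<omega>. \<bar>Z \<omega>\<bar> \<le> E" for Z :: "'w \<Rightarrow> real" and E
  proof -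
    have E: "0 \<le> E" using Z[of undefined] by simp
    show "integrable (P x) (\<lambda>\<omega>. Z \<omega> * h (Xp (s + t) \<omega>))"
      by (rule integrable_P_bounded[where C = "E * D"]) (auto simp: abs_mult E intro!: mult_mono D Z)
    show "integrable (P x) (\<lambda>\<omega>. Z \<omega> * (\<integral>\<omega>'. h (Xp t \<omega>') \<partial>P (Xp s \<omega>)))"
      by (rule integrable_P_bounded[where C = "E * D"])
        (auto simp: abs_mult E D meas intro!: mult_mono Z abs_integral_P_le)
    show "integrable (P x) Z"
      by (rule integrable_P_bounded[where C = E]) (auto simp: Z)
  qed
  have half: "(\<integral>\<omega>. Z \<omega> * h (Xp (s + t) \<omega>) \<partial>P x) = (\<integral>\<omega>. Z \<omega> * (\<integral>\<omega>'. h (Xp t \<omega>') \<partial>P (Xp s \<omega>)) \<partial>P x)"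
    if Z: "Z \<in> borel_measurable (\<F> s)" "\<And>\<omega>. 0 \<le> Z \<omega>" "\<And>\<omega>. Z \<omega> \<le> E" for Z E
  proof -
    have Zm: "Z \<in> borel_measurable M"
      by (rule process_sigma_measurable_M[OF Z(1)]) auto
    have Zb: "\<bar>Z \<omega>\<bar> \<le> E" for \<omega> using Z(2,3)[of \<omega>] by simp
    note i = int[OF Zm Zb]
    have hD: "(\<integral>\<omega>'. h (Xp t \<omega>') + D \<partial>P y) = (\<integral>\<omega>'. h (Xp t \<omega>') \<partial>P y) + D" for y
    proof -
      interpret prob_space "P y" by (rule prob_space_P)
      have "integrable (P y) (\<lambda>\<omega>'. h (Xp t \<omega>'))"
        by (rule integrable_P_bounded[where C = D]) (auto simp: D)
      then show ?thesis using prob_space by simp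
    qed
    have "(\<integral>\<omega>. Z \<omega> * (h (Xp (s + t) \<omega>) + D) \<partial>P x) = (\<integral>\<omega>. Z \<omega> * (\<integral>\<omega>'. h (Xp t \<omega>') + D \<partial>P (Xp s \<omega>)) \<partial>P x)"
    proof (rule pos[where k = "\<lambda>y. h y + D", OF Z])
      show "0 \<le> h y + D" "h y + D \<le> 2 * D" for y using D[of y] by linarith+
    qed measurable
    then show ?thesis unfolding hD using i by (simp add: distrib_left)
  qed
  have "(\<integral>\<omega>. (Y \<omega> + C) * h (Xp (s + t) \<omega>) \<partial>P x) = (\<integral>\<omega>. (Y \<omega> + C) * (\<integral>\<omega>'. h (Xp t \<omega>') \<partial>P (Xp s \<omega>)) \<partial>P x)"
  proof (rule half)
    show "0 \<le> Y \<omega> + C" "Y \<omega> + C \<le> 2 * C" for \<omega> using C[of \<omega>] by (auto simp: abs_le_iff)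
  qed (use Y in measurable)
  moreover have "(\<integral>\<omega>. C * h (Xp (s + t) \<omega>) \<partial>P x) = (\<integral>\<omega>. C * (\<integral>\<omega>'. h (Xp t \<omega>') \<partial>P (Xp s \<omega>)) \<partial>P x)"
    by (rule half[where E = C]) (use CD in auto)
  moreover have "integrable (P x) (\<lambda>\<omega>. C * h (Xp (s + t) \<omega>))"
       "integrable (P x) (\<lambda>\<omega>. C * (\<integral>\<omega>'. h (Xp t \<omega>') \<partial>P (Xp s \<omega>)))"
    using CD by (intro int(1,2)[where E = C]; simp)+
  ultimately show ?thesis
    using int(1,2)[OF Y' C] by (simp only: distrib_right Bochner_Integration.integral_add)
qed
end

section \<open>Moments of additive functionals\<close>

text \<open>
  Throughout, \<open>h\<close> plays the role of the centred intensity \<open>f\<^sub>c\<close>. The random variable \<open>occ s T\<close> is the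
  additive functional \<open>\<integral>\<^sub>s\<^sup>T h (X r) dr\<close>.
\<close>
locale markov_functional = markov M P X
  for M :: "'w measure" and P :: "'s::polish_space \<Rightarrow> 'w measure" and X :: "real \<Rightarrow> 'w \<Rightarrow> 's" +
  fixes h :: "'s \<Rightarrow> real" and B :: real
  assumes h_measurable [measurable]: "h \<in> borel_measurable borel" and h_bound: "\<And>y. \<bar>h y\<bar> \<le> B"
begin

definition occ :: "real \<Rightarrow> real \<Rightarrow> 'w \<Rightarrow> real" where
  "occ s T \<omega> = (LBINT r:{s..T}. h (Xp r \<omega>))"

definition moment :: "nat \<Rightarrow> real \<Rightarrow> 's \<Rightarrow> real" where
  "moment n T y = (\<integral>\<omega>. occ 0 T \<omega> ^ n \<partial>P y)"

lemma B_nonneg: "0 \<le> B"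
  using order_trans[OF abs_ge_zero h_bound] .

lemma occ_measurable [measurable (raw)]:
  assumes [measurable]: "a \<in> borel_measurable K" "b \<in> borel_measurable K" "w \<in> K \<rightarrow>\<^sub>M M"
  shows "(\<lambda>p. occ (a p) (b p) (w p)) \<in> borel_measurable K"
  unfolding occ_def by (rule measurable_Icc_integral) measurable

lemma moment_measurable [measurable (raw)]:
  assumes [measurable]: "\<tau> \<in> borel_measurable K" "y \<in> K \<rightarrow>\<^sub>M borel"
  shows "(\<lambda>p. moment n (\<tau> p) (y p)) \<in> borel_measurable K"
  unfolding moment_def by (rule integral_P_measurable) measurable

lemma path_measurable:
  assumes "\<omega> \<in> space M" shows "(\<lambda>r. h (Xp r \<omega>)) \<in> borel_measurable borel"
  using assms by measurable

lemma occ_bound: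
  assumes "\<omega> \<in> space M" shows "\<bar>occ s T \<omega>\<bar> \<le> B * \<bar>T - s\<bar>"
proof -
  have "\<bar>occ s T \<omega>\<bar> \<le> (LBINT r:{s..T}. B)"
    unfolding occ_def
    by (rule abs_set_integral_le)
      (auto intro: h_bound path_measurable[OF assms] set_integrable_Icc_bounded[where C = B] simp: B_nonneg)
  also have "\<dots> \<le> B * \<bar>T - s\<bar>"
    using B_nonneg by (subst set_integral_const) (auto simp: measure_def emeasure_lborel_Icc_eq)
  finally show ?thesis .
qed


lemma moment_bound: "\<bar>moment n T y\<bar> \<le> (B * \<bar>T\<bar>) ^ n"
  unfolding moment_def
proof (rule abs_integral_P_le)
  show "\<bar>occ 0 T \<omega> ^ n\<bar> \<le> (B * \<bar>T\<bar>) ^ n" if "\<omega> \<in> space M" for \<omega>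
    using occ_bound[OF that, of 0 T] unfolding power_abs by (intro power_mono) auto
qed measurable

lemma moment_0 [simp]: "moment 0 T y = 1"
  using prob_space.prob_space[OF prob_space_P[of y]] by (simp add: moment_def)

lemma past_times_h_measurable:
  assumes "0 \<le> s" "s \<le> r" and Y: "Y \<in> borel_measurable (\<F> s)"
  shows "(\<lambda>\<omega>. Y \<omega> * h (Xp r \<omega>)) \<in> borel_measurable (\<F> r)"
proof -
  have "Y \<in> borel_measurable (\<F> r)"
    by (rule process_sigma_measurable_mono[OF Y]) (use assms in auto)
  moreover have "Xp r \<in> \<F> r \<rightarrow>\<^sub>M borel"
    using X_measurable_process_sigma[of r "{0..r}"] assms by (simp add: Xp_nonneg)
  ultimately show ?thesis by measurable
qed

text \<open>
  The step that raises the exponent. The Markov property for the power \<open>n\<close> is a hypothesis, so that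
  the lemma serves both inside the induction that proves this property and in the recursion for
  the moments.
\<close>
lemma integral_occ_Suc:
  assumes IH: "\<And>r Z C. s \<le> r \<Longrightarrow> r \<le> T \<Longrightarrow> Z \<in> borel_measurable (\<F> r) \<Longrightarrow> (\<And>\<omega>. \<bar>Z \<omega>\<bar> \<le> C) \<Longrightarrow>
      (\<integral>\<omega>. Z \<omega> * occ r T \<omega> ^ n \<partial>P x) = (\<integral>\<omega>. Z \<omega> * moment n (T - r) (Xp r \<omega>) \<partial>P x)"
    and s: "0 \<le> s" and Y: "Y \<in> borel_measurable (\<F> s)" and C: "\<And>\<omega>. \<bar>Y \<omega>\<bar> \<le> C"
  shows "(\<integral>\<omega>. Y \<omega> * occ s T \<omega> ^ Suc n \<partial>P x) =
    real (Suc n) * (LBINT r:{s..T}. (\<integral>\<omega>. Y \<omega> * (h (Xp r \<omega>) * moment n (T - r) (Xp r \<omega>)) \<partial>P x))"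
proof -
  interpret P: prob_space "P x" by (rule prob_space_P)
  have [measurable]: "Y \<in> borel_measurable M"
    by (rule process_sigma_measurable_M[OF Y]) auto
  have C0: "0 \<le> C" using order_trans[OF abs_ge_zero C] .
  let ?F = "\<lambda>r \<omega>. Y \<omega> * (h (Xp r \<omega>) * occ r T \<omega> ^ n)"
  have "(\<integral>\<omega>. Y \<omega> * occ s T \<omega> ^ Suc n \<partial>P x) = (\<integral>\<omega>. real (Suc n) * (LBINT r:{s..T}. ?F r \<omega>) \<partial>P x)"
  proof (rule Bochner_Integration.integral_cong)
    fix \<omega> assume "\<omega> \<in> space (P x)"
    then have "occ s T \<omega> ^ Suc n = real (Suc n) * (LBINT r:{s..T}. h (Xp r \<omega>) * occ r T \<omega> ^ n)"
      unfolding occ_def by (intro power_integral_eq_iterated[where C = B] path_measurable h_bound) auto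
    then show "Y \<omega> * occ s T \<omega> ^ Suc n = real (Suc n) * (LBINT r:{s..T}. ?F r \<omega>)"
      by simp
  qed simp
  also have "\<dots> = real (Suc n) * (\<integral>\<omega>. (LBINT r:{s..T}. ?F r \<omega>) \<partial>P x)"
    by simp
  also have "(\<integral>\<omega>. (LBINT r:{s..T}. ?F r \<omega>) \<partial>P x) = (LINT \<omega>:space (P x)|P x. (LBINT r:{s..T}. ?F r \<omega>))"
    by (rule set_integral_over_space[symmetric])
  also have "\<dots> = (LBINT r:{s..T}. (LINT \<omega>:space (P x)|P x. ?F r \<omega>))"
  proof (rule set_integral_swap)
    fix r \<omega> assume "r \<in> {s..T}" "\<omega> \<in> space (P x)"
    then have "B * \<bar>T - r\<bar> \<le> B * \<bar>T - s\<bar>" "\<bar>occ r T \<omega>\<bar> \<le> B * \<bar>T - r\<bar>"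
      using B_nonneg occ_bound[of \<omega> r T] by (auto intro: mult_left_mono)
    then show "\<bar>?F r \<omega>\<bar> \<le> C * (B * (B * \<bar>T - s\<bar>) ^ n)"
      unfolding abs_mult power_abs using B_nonneg C0
      by (intro mult_mono C h_bound power_mono) auto
  qed (auto simp: emeasure_lborel_Icc_eq lborel.sigma_finite_measure_axioms P.sigma_finite_measure_axioms P.emeasure_space_1)
  also have "\<dots> = (LBINT r:{s..T}. (\<integral>\<omega>. ?F r \<omega> \<partial>P x))"
    by (simp only: set_integral_over_space)
  also have "\<dots> = (LBINT r:{s..T}. (\<integral>\<omega>. Y \<omega> * (h (Xp r \<omega>) * moment n (T - r) (Xp r \<omega>)) \<partial>P x))"
  proof (rule set_lebesgue_integral_cong, simp, safe)
    fix r assume r: "r \<in> {s..T}"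
    have "\<bar>Y \<omega> * h (Xp r \<omega>)\<bar> \<le> C * B" for \<omega>
      unfolding abs_mult by (intro mult_mono C h_bound) (auto simp: C0)
    from IH[OF _ _ past_times_h_measurable[OF s _ Y] this] r
    show "(\<integral>\<omega>. ?F r \<omega> \<partial>P x) = (\<integral>\<omega>. Y \<omega> * (h (Xp r \<omega>) * moment n (T - r) (Xp r \<omega>)) \<partial>P x)"
      by (simp add: mult.assoc)
  qed
  finally show ?thesis .
qed

lemma moment_Suc_aux:
  assumes IH: "\<And>r Z C. 0 \<le> r \<Longrightarrow> r \<le> T \<Longrightarrow> Z \<in> borel_measurable (\<F> r) \<Longrightarrow> (\<And>\<omega>. \<bar>Z \<omega>\<bar> \<le> C) \<Longrightarrow>
      (\<integral>\<omega>. Z \<omega> * occ r T \<omega> ^ n \<partial>P x) = (\<integral>\<omega>. Z \<omega> * moment n (T - r) (Xp r \<omega>) \<partial>P x)"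
  shows "moment (Suc n) T x =
    real (Suc n) * (LBINT r:{0..T}. (\<integral>\<omega>. h (Xp r \<omega>) * moment n (T - r) (Xp r \<omega>) \<partial>P x))"
proof -
  have "(\<integral>\<omega>. 1 * occ 0 T \<omega> ^ Suc n \<partial>P x) =
    real (Suc n) * (LBINT r:{0..T}. (\<integral>\<omega>. 1 * (h (Xp r \<omega>) * moment n (T - r) (Xp r \<omega>)) \<partial>P x))"
  proof (rule integral_occ_Suc[where C = 1])
    fix r C and Z :: "'w \<Rightarrow> real" assume "0 \<le> r" "r \<le> T" "Z \<in> borel_measurable (\<F> r)" "\<And>\<omega>. \<bar>Z \<omega>\<bar> \<le> C"
    then show "(\<integral>\<omega>. Z \<omega> * occ r T \<omega> ^ n \<partial>P x) = (\<integral>\<omega>. Z \<omega> * moment n (T - r) (Xp r \<omega>) \<partial>P x)"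
      by (rule IH)
  qed auto
  then show ?thesis by (simp only: moment_def mult_1_left)
qed

text \<open>
  The Markov property for functionals of the whole future up to time \<open>T\<close>. The factor \<open>Y\<close> must be an
  arbitrary bounded function of the past: in the induction step it absorbs the factor \<open>h (X r)\<close>.
\<close>
lemma markov_occ:
  fixes Y :: "'w \<Rightarrow> real"
  assumes "0 \<le> s" "s \<le> T" "Y \<in> borel_measurable (\<F> s)" "\<And>\<omega>. \<bar>Y \<omega>\<bar> \<le> C"
  shows "(\<integral>\<omega>. Y \<omega> * occ s T \<omega> ^ n \<partial>P x) = (\<integral>\<omega>. Y \<omega> * moment n (T - s) (Xp s \<omega>) \<partial>P x)"
  using assms
proof (induction n arbitrary: s T Y C x)
  case 0
  then show ?case by simp
next
  case (Suc n)
  interpret P: prob_space "P x" by (rule prob_space_P)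
  note Y = Suc.prems(3) and C = Suc.prems(4)
  have [measurable]: "Y \<in> borel_measurable M"
    by (rule process_sigma_measurable_M[OF Y]) auto
  have C0: "0 \<le> C" using order_trans[OF abs_ge_zero C] .
  define k where "k = (\<lambda>r y. h y * moment n (T - r) y)"
  have [measurable]: "(\<lambda>p. k (\<tau> p) (y p)) \<in> borel_measurable K"
    if [measurable]: "\<tau> \<in> borel_measurable K" "y \<in> K \<rightarrow>\<^sub>M borel" for \<tau> y K
    unfolding k_def by measurable
  define E where "E = B * (B * \<bar>T - s\<bar>) ^ n"
  have k_bound: "\<bar>k r y\<bar> \<le> E" if "r \<in> {s..T}" for r y
    unfolding k_def E_def abs_mult
  proof (intro mult_mono h_bound)
    have "B * \<bar>T - r\<bar> \<le> B * \<bar>T - s\<bar>" using that B_nonneg by (auto intro: mult_left_mono)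
    then show "\<bar>moment n (T - r) y\<bar> \<le> (B * \<bar>T - s\<bar>) ^ n"
      using B_nonneg by (intro order_trans[OF moment_bound] power_mono) auto
  qed (auto simp: B_nonneg)
  let ?G = "\<lambda>r \<omega>. \<integral>\<omega>'. k r (Xp (r - s) \<omega>') \<partial>P (Xp s \<omega>)"
  have [measurable]: "(\<lambda>p. ?G (fst p) (snd p)) \<in> borel_measurable (lborel \<Otimes>\<^sub>M M)"
    by (rule integral_P_measurable) measurable
  have "(\<integral>\<omega>. Y \<omega> * occ s T \<omega> ^ Suc n \<partial>P x) = real (Suc n) * (LBINT r:{s..T}. (\<integral>\<omega>. Y \<omega> * k r (Xp r \<omega>) \<partial>P x))"
    unfolding k_def
  proof (rule integral_occ_Suc[OF _ _ Y C])
    fix r D and Z :: "'w \<Rightarrow> real" assume "s \<le> r" "r \<le> T" "Z \<in> borel_measurable (\<F> r)" "\<And>\<omega>. \<bar>Z \<omega>\<bar> \<le> D"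
    then show "(\<integral>\<omega>. Z \<omega> * occ r T \<omega> ^ n \<partial>P x) = (\<integral>\<omega>. Z \<omega> * moment n (T - r) (Xp r \<omega>) \<partial>P x)"
      using Suc.prems(1) by (intro Suc.IH) auto
  qed fact
  also have "(LBINT r:{s..T}. (\<integral>\<omega>. Y \<omega> * k r (Xp r \<omega>) \<partial>P x)) = (LBINT r:{s..T}. (\<integral>\<omega>. Y \<omega> * ?G r \<omega> \<partial>P x))"
  proof (rule set_lebesgue_integral_cong, simp, safe)
    fix r assume r: "r \<in> {s..T}"
    have "k r \<in> borel_measurable borel" by measurable
    from markov_integral[OF Suc.prems(1) _ Y C this k_bound[OF r], of "r - s" x] r
    show "(\<integral>\<omega>. Y \<omega> * k r (Xp r \<omega>) \<partial>P x) = (\<integral>\<omega>. Y \<omega> * ?G r \<omega> \<partial>P x)" by simp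
  qed
  also have "\<dots> = (LBINT r:{s..T}. (LINT \<omega>:space (P x)|P x. Y \<omega> * ?G r \<omega>))"
    by (simp only: set_integral_over_space)
  also have "\<dots> = (LINT \<omega>:space (P x)|P x. (LBINT r:{s..T}. Y \<omega> * ?G r \<omega>))"
  proof (rule set_integral_swap[symmetric])
    fix r \<omega> assume "r \<in> {s..T}" "\<omega> \<in> space (P x)"
    then show "\<bar>Y \<omega> * ?G r \<omega>\<bar> \<le> C * E"
      unfolding abs_mult by (intro mult_mono C abs_integral_P_le k_bound) (auto simp: C0)
  qed (auto simp: emeasure_lborel_Icc_eq lborel.sigma_finite_measure_axioms P.sigma_finite_measure_axioms P.emeasure_space_1)
  also have "\<dots> = (\<integral>\<omega>. (LBINT r:{s..T}. Y \<omega> * ?G r \<omega>) \<partial>P x)"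
    by (simp only: set_integral_over_space)
  finally have "(\<integral>\<omega>. Y \<omega> * occ s T \<omega> ^ Suc n \<partial>P x) = real (Suc n) * (\<integral>\<omega>. (LBINT r:{s..T}. Y \<omega> * ?G r \<omega>) \<partial>P x)" .
  also have "\<dots> = (\<integral>\<omega>. real (Suc n) * (LBINT r:{s..T}. Y \<omega> * ?G r \<omega>) \<partial>P x)"
    by (simp only: integral_mult_right_zero)
  also have "\<dots> = (\<integral>\<omega>. Y \<omega> * moment (Suc n) (T - s) (Xp s \<omega>) \<partial>P x)"
  proof (rule Bochner_Integration.integral_cong)
    fix \<omega>
    have "moment (Suc n) (T - s) (Xp s \<omega>) =
      real (Suc n) * (LBINT r:{0..T - s}. (\<integral>\<omega>'. h (Xp r \<omega>') * moment n (T - s - r) (Xp r \<omega>') \<partial>P (Xp s \<omega>)))"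
    proof (rule moment_Suc_aux)
      fix r D and Z :: "'w \<Rightarrow> real" assume "0 \<le> r" "r \<le> T - s" "Z \<in> borel_measurable (\<F> r)" "\<And>\<omega>. \<bar>Z \<omega>\<bar> \<le> D"
      then show "(\<integral>\<omega>'. Z \<omega>' * occ r (T - s) \<omega>' ^ n \<partial>P (Xp s \<omega>)) = (\<integral>\<omega>'. Z \<omega>' * moment n (T - s - r) (Xp r \<omega>') \<partial>P (Xp s \<omega>))"
        by (intro Suc.IH) auto
    qed
    also have "(LBINT r:{0..T - s}. (\<integral>\<omega>'. h (Xp r \<omega>') * moment n (T - s - r) (Xp r \<omega>') \<partial>P (Xp s \<omega>)))
        = (LBINT r:{s..T}. ?G r \<omega>)"
      unfolding k_def by (subst set_integral_Icc_shift[symmetric]) simp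
    finally show "real (Suc n) * (LBINT r:{s..T}. Y \<omega> * ?G r \<omega>) = Y \<omega> * moment (Suc n) (T - s) (Xp s \<omega>)"
      by (simp only: set_integral_mult_right mult.left_commute)
  qed simp
  finally show ?case .
qed

lemma moment_Suc: "moment (Suc n) T x =
    real (Suc n) * (LBINT r:{0..T}. (\<integral>\<omega>. h (Xp r \<omega>) * moment n (T - r) (Xp r \<omega>) \<partial>P x))"
  by (rule moment_Suc_aux) (rule markov_occ)

end

section \<open>Moment asymptotics under geometric ergodicity\<close>

locale ergodic_functional = markov_functional M P X h B
  for M :: "'w measure" and P :: "'s::polish_space \<Rightarrow> 'w measure" and X :: "real \<Rightarrow> 'w \<Rightarrow> 's"
    and h :: "'s \<Rightarrow> real" and B :: real +
  fixes v :: "'s \<Rightarrow> real" and \<pi> :: "'s measure" and d \<alpha> :: real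
  assumes v_measurable [measurable]: "v \<in> borel_measurable borel" and v_ge_1: "\<And>y. 1 \<le> v y"
    and prob_\<pi>: "prob_space \<pi>" and sets_\<pi> [measurable_cong]: "sets \<pi> = sets borel"
    and v_integrable: "integrable \<pi> v"
    and v_integrable_P: "\<And>x t. 0 \<le> t \<Longrightarrow> integrable (P x) (\<lambda>\<omega>. v (Xp t \<omega>))"
    and \<alpha>_pos: "0 < \<alpha>" and d_nonneg: "0 \<le> d"
    and mixing_v: "\<And>k x t. k \<in> borel_measurable borel \<Longrightarrow> (\<And>y. \<bar>k y\<bar> \<le> v y) \<Longrightarrow> 0 \<le> t \<Longrightarrow>
      \<bar>(\<integral>\<omega>. k (Xp t \<omega>) \<partial>P x) - (\<integral>y. k y \<partial>\<pi>)\<bar> \<le> d * v x * exp (- \<alpha> * t)"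
    and centred: "(\<integral>y. h y \<partial>\<pi>) = 0"
begin

definition g :: "'s \<Rightarrow> real" where
  "g y = (LBINT s:{0..}. (\<integral>\<omega>. h (Xp s \<omega>) \<partial>P y))"

definition \<sigma>2 :: real where "\<sigma>2 = 2 * (\<integral>y. h y * g y \<partial>\<pi>)"

text \<open>
  Expectations along the process inflate the weight \<open>v\<close> by at most the factor \<open>D\<close>; \<open>C1\<close> and \<open>C2\<close> bound
  the errors in the asymptotics of the first two moments, \<open>C3\<close> and \<open>C4\<close> the growth of the next two. They are kept explicit, because the bounds have to hold
  uniformly in the starting point (which enters through \<open>v\<close> only) and in the length of the time
  interval.
\<close>
definition D :: real where "D = (\<integral>y. v y \<partial>\<pi>) + d"
definition C1 :: real where "C1 = B * d / \<alpha>"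
definition C2 :: real where "C2 = 2 * (B * C1 * D / \<alpha>)"
definition C3 :: real where "C3 = 3 * (\<bar>\<sigma>2\<bar> * B * d / \<alpha> + B * C2 * D)"
definition C4 :: real where "C4 = 4 * (B * C3 * D)"

lemma v_nonneg: "0 \<le> v y"
  using v_ge_1[of y] by linarith

lemma \<pi>v_nonneg: "0 \<le> (\<integral>y. v y \<partial>\<pi>)"
  by (simp add: v_nonneg)

lemma constants_nonneg: "0 \<le> D" "0 \<le> C1" "0 \<le> C2" "0 \<le> C3" "0 \<le> C4"
proof -
  show D: "0 \<le> D" using \<pi>v_nonneg d_nonneg by (simp add: D_def)
  show C1: "0 \<le> C1" using B_nonneg d_nonneg \<alpha>_pos by (simp add: C1_def)
  show C2: "0 \<le> C2" using B_nonneg D C1 \<alpha>_pos by (simp add: C2_def)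
  show C3: "0 \<le> C3" using B_nonneg D C2 d_nonneg \<alpha>_pos by (simp add: C3_def)
  show "0 \<le> C4" using B_nonneg D C3 by (simp add: C4_def)
qed

text \<open>
  Geometric ergodicity controls functions bounded by \<open>v\<close>; scaling extends this to multiples of \<open>v\<close>.
\<close>
lemma mixing:
  assumes [measurable]: "k \<in> borel_measurable borel" and k: "\<And>y. \<bar>k y\<bar> \<le> c * v y" and c: "0 \<le> c" and t: "0 \<le> t"
  shows "\<bar>(\<integral>\<omega>. k (Xp t \<omega>) \<partial>P x) - (\<integral>y. k y \<partial>\<pi>)\<bar> \<le> c * d * v x * exp (- \<alpha> * t)"
proof (cases "c = 0")
  case True
  then have "k y = 0" for y using k[of y] by simp
  then show ?thesis using True by simp
next
  case False
  then have c: "0 < c" using c by simp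
  have "\<bar>(\<integral>\<omega>. k (Xp t \<omega>) / c \<partial>P x) - (\<integral>y. k y / c \<partial>\<pi>)\<bar> \<le> d * v x * exp (- \<alpha> * t)"
    using k c t by (intro mixing_v) (auto simp: abs_divide divide_le_eq mult.commute)
  also have "\<bar>(\<integral>\<omega>. k (Xp t \<omega>) / c \<partial>P x) - (\<integral>y. k y / c \<partial>\<pi>)\<bar> = \<bar>(\<integral>\<omega>. k (Xp t \<omega>) \<partial>P x) - (\<integral>y. k y \<partial>\<pi>)\<bar> / c"
    using c by (simp add: diff_divide_distrib[symmetric] abs_divide)
  finally show ?thesis using c by (simp add: divide_le_eq ac_simps)
qed

lemma integrable_P_dominated:
  assumes [measurable]: "k \<in> borel_measurable borel" and k: "\<And>y. \<bar>k y\<bar> \<le> c * v y" and t: "0 \<le> t"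
  shows "integrable (P x) (\<lambda>\<omega>. k (Xp t \<omega>))"
proof (rule Bochner_Integration.integrable_bound)
  show "integrable (P x) (\<lambda>\<omega>. c * v (Xp t \<omega>))" using v_integrable_P[OF t] by simp
  show "AE \<omega> in P x. norm (k (Xp t \<omega>)) \<le> norm (c * v (Xp t \<omega>))"
    using k by (auto intro!: AE_I2 intro: order_trans[OF _ abs_ge_self])
qed measurable

text \<open>
  Expectations along the process preserve bounds by a multiple of \<open>v\<close>. This lets the recursion for
  the moments be iterated.
\<close>
lemma mean_v_le: "0 \<le> t \<Longrightarrow> (\<integral>\<omega>. v (Xp t \<omega>) \<partial>P x) \<le> D * v x"
proof -
  assume t: "0 \<le> t"
  have "\<bar>(\<integral>\<omega>. v (Xp t \<omega>) \<partial>P x) - (\<integral>y. v y \<partial>\<pi>)\<bar> \<le> d * v x * exp (- \<alpha> * t)"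
    by (rule mixing_v) (auto simp: v_nonneg t)
  also have "\<dots> \<le> d * v x"
    using d_nonneg v_nonneg[of x] t \<alpha>_pos by (intro mult_left_le) auto
  finally have "(\<integral>\<omega>. v (Xp t \<omega>) \<partial>P x) \<le> (\<integral>y. v y \<partial>\<pi>) + d * v x" by linarith
  also have "\<dots> \<le> (\<integral>y. v y \<partial>\<pi>) * v x + d * v x"
    using mult_left_mono[OF v_ge_1[of x] \<pi>v_nonneg] by simp
  finally show ?thesis by (simp add: D_def distrib_right)
qed

lemma mean_dominated:
  assumes [measurable]: "k \<in> borel_measurable borel" and k: "\<And>y. \<bar>k y\<bar> \<le> c * v y" and c: "0 \<le> c" and t: "0 \<le> t"
  shows "\<bar>\<integral>\<omega>. k (Xp t \<omega>) \<partial>P x\<bar> \<le> c * D * v x"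
proof -
  have "\<bar>\<integral>\<omega>. k (Xp t \<omega>) \<partial>P x\<bar> \<le> (\<integral>\<omega>. \<bar>k (Xp t \<omega>)\<bar> \<partial>P x)" by (rule integral_abs_bound)
  also have "\<dots> \<le> (\<integral>\<omega>. c * v (Xp t \<omega>) \<partial>P x)"
    using integrable_P_dominated[OF assms(1) k t] v_integrable_P[OF t] k by (intro integral_mono) auto
  also have "\<dots> \<le> c * (D * v x)"
    using mult_left_mono[OF mean_v_le[OF t] c] by simp
  finally show ?thesis by simp
qed

lemma mean_measurable [measurable (raw)]:
  fixes k :: "'a \<Rightarrow> 's \<Rightarrow> real"
  assumes [measurable]: "\<tau> \<in> borel_measurable K" "y \<in> K \<rightarrow>\<^sub>M borel" "(\<lambda>(p, y). k p y) \<in> borel_measurable (K \<Otimes>\<^sub>M borel)"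
  shows "(\<lambda>p. \<integral>\<omega>. k p (Xp (\<tau> p) \<omega>) \<partial>P (y p)) \<in> borel_measurable K"
  by (rule integral_P_measurable) measurable

lemma h_bound_v: "\<bar>h y\<bar> \<le> B * v y"
  using h_bound[of y] mult_left_mono[OF v_ge_1[of y] B_nonneg] by simp

lemma mean_h_decay: "0 \<le> t \<Longrightarrow> \<bar>\<integral>\<omega>. h (Xp t \<omega>) \<partial>P x\<bar> \<le> B * d * v x * exp (- \<alpha> * t)"
  using mixing[OF h_measurable h_bound_v B_nonneg, of t x] by (simp add: centred)

lemma g_measurable [measurable]: "g \<in> borel_measurable borel"
  unfolding g_def set_lebesgue_integral_def
  by (rule lborel.borel_measurable_lebesgue_integral) measurable

lemma moment_1: "moment 1 T x = (LBINT r:{0..T}. (\<integral>\<omega>. h (Xp r \<omega>) \<partial>P x))"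
  using moment_Suc[of 0 T x] by simp

lemma moment_1_bound: "\<bar>moment 1 T x\<bar> \<le> C1 * v x"
proof -
  have "\<bar>moment 1 T x\<bar> \<le> (LBINT r:{0..T}. (B * d * v x) * exp (- \<alpha> * r))"
    unfolding moment_1 using exp_decay_integral_Icc(1)[OF \<alpha>_pos, of T]
    by (intro abs_set_integral_le) (auto intro!: mean_h_decay[simplified])
  also have "\<dots> \<le> (B * d * v x) * (1 / \<alpha>)"
    using exp_decay_integral_Icc(2)[OF \<alpha>_pos, of T] B_nonneg d_nonneg v_nonneg[of x]
    by (simp only: set_integral_mult_right) (intro mult_left_mono, auto)
  finally show ?thesis by (simp add: C1_def)
qed

text \<open>
  The difference is the integral of the exponentially decaying \<open>E\<^sub>x h (X r)\<close> over \<open>r > T\<close>.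
\<close>
lemma moment_1_limit:
  assumes T: "0 \<le> T"
  shows "\<bar>moment 1 T x - g x\<bar> \<le> C1 * v x * exp (- \<alpha> * T)"
proof -
  let ?m = "\<lambda>r. \<integral>\<omega>. h (Xp r \<omega>) \<partial>P x"
  have int: "set_integrable lborel A ?m" if "A \<subseteq> {0..}" "A \<in> sets lborel" for A
  proof -
    have "set_integrable lborel {0..} ?m"
    proof (rule set_integrable_bound)
      show "set_integrable lborel {0..} (\<lambda>r. (B * d * v x) * exp (- \<alpha> * r))"
        using exp_decay_integral(1)[OF \<alpha>_pos, of 0] by simp
    qed (auto simp: set_borel_measurable_def intro!: AE_I2 mean_h_decay[THEN order_trans, simplified])
    from set_integrable_subset[OF this that(2,1)] show ?thesis .
  qed
  have "{0..} = {0..T} \<union> {T..}" using T by auto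
  then have "g x = (LBINT r:{0..T} \<union> {T..}. ?m r)"
    by (simp only: g_def)
  also have "\<dots> = moment 1 T x + (LBINT r:{T..}. ?m r)" unfolding moment_1
    by (rule set_integral_Un_AE) (use AE_lborel_singleton[of T] T in \<open>auto intro!: int elim!: eventually_mono\<close>)
  finally have "\<bar>moment 1 T x - g x\<bar> = \<bar>LBINT r:{T..}. ?m r\<bar>" by simp
  also have "\<dots> \<le> (LBINT r:{T..}. (B * d * v x) * exp (- \<alpha> * r))"
    using exp_decay_integral(1)[OF \<alpha>_pos, of T] T
    by (intro abs_set_integral_le) (auto intro!: mean_h_decay[simplified])
  also have "\<dots> = (B * d * v x) * (exp (- \<alpha> * T) / \<alpha>)"
    by (simp only: set_integral_mult_right exp_decay_integral(2)[OF \<alpha>_pos])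
  finally show ?thesis by (simp add: C1_def)
qed

lemma g_bound: "\<bar>g x\<bar> \<le> C1 * v x"
proof -
  have "moment 1 0 x = 0" using moment_bound[of 1 0 x] by simp
  then show ?thesis using moment_1_limit[of 0 x] by simp
qed

text \<open>
  The integrand of the recursion at time \<open>r\<close> is the expectation of \<open>h (X r) a\<^sub>1(T - r, X r)\<close>. Away from the
  two ends of \<open>[0, T]\<close> the law of \<open>X r\<close> is close to \<open>\<pi>\<close> and \<open>a\<^sub>1(T - r, \<cdot>)\<close> is close to \<open>g\<close>, so that the
  integrand is close to \<open>\<sigma>\<^sup>2 / 2\<close>; the errors decay exponentially from the left and from the right end.
\<close>
lemma moment_2_expansion:
  assumes T: "0 \<le> T"
  shows "\<bar>moment 2 T x - \<sigma>2 * T\<bar> \<le> C2 * v x"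
proof -
  interpret \<pi>: prob_space \<pi> by (rule prob_\<pi>)
  define k where "k = (\<lambda>r y. h y * moment 1 (T - r) y)"
  have [measurable]: "(\<lambda>p. k (\<tau> p) (y p)) \<in> borel_measurable K"
    if [measurable]: "\<tau> \<in> borel_measurable K" "y \<in> K \<rightarrow>\<^sub>M borel" for \<tau> y K
    unfolding k_def by measurable
  let ?m = "\<lambda>r. \<integral>\<omega>. k r (Xp r \<omega>) \<partial>P x"
  have k_bound: "\<bar>k r y\<bar> \<le> (B * C1) * v y" for r y
    unfolding k_def abs_mult using B_nonneg
    by (auto simp: mult.assoc intro!: mult_mono h_bound moment_1_bound[simplified])
  have hg_bound: "\<bar>h y * g y\<bar> \<le> (B * C1) * v y" for y
    unfolding abs_mult using B_nonneg by (auto simp: mult.assoc intro!: mult_mono h_bound g_bound)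
  have int\<pi>: "integrable \<pi> q" if [measurable]: "q \<in> borel_measurable borel" and q: "\<And>y. \<bar>q y\<bar> \<le> (B * C1) * v y" for q
    by (rule Bochner_Integration.integrable_bound[where f = "\<lambda>y. (B * C1) * v y"])
      (use v_integrable q in \<open>auto intro!: AE_I2 intro: order_trans[OF _ abs_ge_self]\<close>)
  have step: "\<bar>?m r - \<sigma>2 / 2\<bar> \<le> (B * C1 * d * v x) * exp (- \<alpha> * r) + (B * C1 * (\<integral>y. v y \<partial>\<pi>)) * exp (- \<alpha> * (T - r))"
    if r: "r \<in> {0..T}" for r
  proof -
    have 1: "\<bar>?m r - (\<integral>y. k r y \<partial>\<pi>)\<bar> \<le> (B * C1) * d * v x * exp (- \<alpha> * r)"
      using r B_nonneg constants_nonneg by (intro mixing k_bound) auto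
    have "(\<integral>y. k r y \<partial>\<pi>) - \<sigma>2 / 2 = (\<integral>y. k r y - h y * g y \<partial>\<pi>)"
      unfolding \<sigma>2_def by (subst Bochner_Integration.integral_diff) (auto intro!: int\<pi> k_bound hg_bound)
    also have "\<bar>\<dots>\<bar> \<le> (\<integral>y. \<bar>k r y - h y * g y\<bar> \<partial>\<pi>)" by (rule integral_abs_bound)
    also have "\<dots> \<le> (\<integral>y. (B * C1 * exp (- \<alpha> * (T - r))) * v y \<partial>\<pi>)"
    proof (rule integral_mono)
      fix y
      have "\<bar>k r y - h y * g y\<bar> = \<bar>h y\<bar> * \<bar>moment 1 (T - r) y - g y\<bar>"
        unfolding k_def abs_mult[symmetric] by (simp add: right_diff_distrib)
      also have "\<dots> \<le> B * (C1 * v y * exp (- \<alpha> * (T - r)))"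
        using r B_nonneg by (intro mult_mono h_bound moment_1_limit) auto
      finally show "\<bar>k r y - h y * g y\<bar> \<le> (B * C1 * exp (- \<alpha> * (T - r))) * v y" by (simp add: ac_simps)
    qed (auto intro!: integrable_abs Bochner_Integration.integrable_diff int\<pi>[OF _ k_bound] int\<pi>[OF _ hg_bound] v_integrable)
    finally have 2: "\<bar>(\<integral>y. k r y \<partial>\<pi>) - \<sigma>2 / 2\<bar> \<le> (B * C1 * (\<integral>y. v y \<partial>\<pi>)) * exp (- \<alpha> * (T - r))"
      by (simp add: ac_simps)
    show ?thesis using 1 2 by linarith
  qed
  have m_int: "set_integrable lborel {0..T} ?m"
    by (rule set_integrable_Icc_bounded[where C = "B * C1 * D * v x"])
      (use B_nonneg constants_nonneg in \<open>auto intro!: mean_dominated k_bound\<close>)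
  have "moment 2 T x - \<sigma>2 * T = 2 * (LBINT r:{0..T}. ?m r) - 2 * (LBINT r:{0..T}. \<sigma>2 / 2)"
    using moment_Suc[of 1 T x] T by (simp add: k_def numeral_2_eq_2 set_integral_const measure_def)
  also have "\<dots> = 2 * (LBINT r:{0..T}. ?m r - \<sigma>2 / 2)"
    using m_int by (subst set_integral_diff) auto
  finally have eq: "\<bar>moment 2 T x - \<sigma>2 * T\<bar> = 2 * \<bar>LBINT r:{0..T}. ?m r - \<sigma>2 / 2\<bar>" by (simp add: abs_mult)
  have "\<bar>LBINT r:{0..T}. ?m r - \<sigma>2 / 2\<bar>
      \<le> (LBINT r:{0..T}. (B * C1 * d * v x) * exp (- \<alpha> * r) + (B * C1 * (\<integral>y. v y \<partial>\<pi>)) * exp (- \<alpha> * (T - r)))"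
  proof (rule abs_set_integral_le)
    show "set_integrable lborel {0..T} (\<lambda>r. (B * C1 * d * v x) * exp (- \<alpha> * r) + (B * C1 * (\<integral>y. v y \<partial>\<pi>)) * exp (- \<alpha> * (T - r)))"
      by (intro set_integral_add(1) set_integrable_mult_right exp_decay_integral_Icc \<alpha>_pos)
    show "(\<lambda>r. ?m r - \<sigma>2 / 2) \<in> borel_measurable lborel" by measurable
    show "{0..T} \<in> sets lborel" by simp
    show "\<bar>?m r - \<sigma>2 / 2\<bar> \<le> (B * C1 * d * v x) * exp (- \<alpha> * r) + (B * C1 * (\<integral>y. v y \<partial>\<pi>)) * exp (- \<alpha> * (T - r))"
      if "r \<in> {0..T}" for r using that by (rule step)
  qed
  also have "\<dots> = (B * C1 * d * v x) * (LBINT r:{0..T}. exp (- \<alpha> * r)) + (B * C1 * (\<integral>y. v y \<partial>\<pi>)) * (LBINT r:{0..T}. exp (- \<alpha> * (T - r)))"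
  proof -
    have *: "set_integrable lborel {0..T} (\<lambda>r. (B * C1 * d * v x) * exp (- \<alpha> * r))"
      "set_integrable lborel {0..T} (\<lambda>r. (B * C1 * (\<integral>y. v y \<partial>\<pi>)) * exp (- \<alpha> * (T - r)))"
      by (intro set_integrable_mult_right exp_decay_integral_Icc \<alpha>_pos)+
    show ?thesis unfolding set_integral_add(2)[OF *] by (simp only: set_integral_mult_right)
  qed
  also have "\<dots> \<le> (B * C1 * d * v x) * (1 / \<alpha>) + (B * C1 * (\<integral>y. v y \<partial>\<pi>)) * (1 / \<alpha>)"
    using exp_decay_integral_Icc(2,4)[OF \<alpha>_pos, of T] B_nonneg constants_nonneg d_nonneg \<pi>v_nonneg v_nonneg[of x]
    by (intro add_mono mult_left_mono) auto
  also have "\<dots> \<le> (B * C1 * d * v x) * (1 / \<alpha>) + (B * C1 * ((\<integral>y. v y \<partial>\<pi>) * v x)) * (1 / \<alpha>)"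
    using mult_left_mono[OF v_ge_1[of x] \<pi>v_nonneg] B_nonneg constants_nonneg \<alpha>_pos
    by (intro add_left_mono mult_right_mono mult_left_mono) auto
  also have "\<dots> = (B * C1 * D / \<alpha>) * v x" by (simp add: D_def algebra_simps add_divide_distrib)
  finally show ?thesis unfolding eq by (simp add: C2_def)
qed

text \<open>
  Substituting \<open>a\<^sub>2(T - r, y) = \<sigma>\<^sup>2 (T - r) + O(v y)\<close> in the recursion, the leading term does not depend on
  \<open>y\<close> and is multiplied by \<open>E\<^sub>x h (X r)\<close>, which decays exponentially. So the third moment has order
  \<open>T\<close> rather than \<open>T\<^sup>2\<close>.
\<close>
lemma moment_3_bound:
  assumes T: "0 \<le> T"
  shows "\<bar>moment 3 T x\<bar> \<le> C3 * T * v x"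
proof -
  define R where "R = (\<lambda>r y. h y * (moment 2 (T - r) y - \<sigma>2 * (T - r)))"
  have [measurable]: "(\<lambda>p. R (\<tau> p) (y p)) \<in> borel_measurable K"
    if [measurable]: "\<tau> \<in> borel_measurable K" "y \<in> K \<rightarrow>\<^sub>M borel" for \<tau> y K
    unfolding R_def by measurable
  let ?m = "\<lambda>r. \<integral>\<omega>. h (Xp r \<omega>) * moment 2 (T - r) (Xp r \<omega>) \<partial>P x"
  have step: "\<bar>?m r\<bar> \<le> (\<bar>\<sigma>2\<bar> * T * B * d * v x) * exp (- \<alpha> * r) + B * C2 * D * v x"
    if r: "r \<in> {0..T}" for r
  proof -
    have R_bound: "\<bar>R r y\<bar> \<le> (B * C2) * v y" for y
      unfolding R_def abs_mult using B_nonneg r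
      by (auto simp: mult.assoc intro!: mult_mono h_bound moment_2_expansion)
    have "?m r = (\<integral>\<omega>. (\<sigma>2 * (T - r)) * h (Xp r \<omega>) + R r (Xp r \<omega>) \<partial>P x)"
      unfolding R_def by (intro Bochner_Integration.integral_cong) (auto simp: algebra_simps)
    also have "\<dots> = (\<sigma>2 * (T - r)) * (\<integral>\<omega>. h (Xp r \<omega>) \<partial>P x) + (\<integral>\<omega>. R r (Xp r \<omega>) \<partial>P x)"
      using r by (subst Bochner_Integration.integral_add)
        (auto intro!: integrable_P_dominated[OF _ R_bound] integrable_P_dominated[OF _ h_bound_v])
    finally have eq: "?m r = (\<sigma>2 * (T - r)) * (\<integral>\<omega>. h (Xp r \<omega>) \<partial>P x) + (\<integral>\<omega>. R r (Xp r \<omega>) \<partial>P x)" .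
    have "\<bar>(\<sigma>2 * (T - r)) * (\<integral>\<omega>. h (Xp r \<omega>) \<partial>P x)\<bar> \<le> (\<bar>\<sigma>2\<bar> * T) * (B * d * v x * exp (- \<alpha> * r))"
      unfolding abs_mult using r by (intro mult_mono mean_h_decay) auto
    moreover have "\<bar>\<integral>\<omega>. R r (Xp r \<omega>) \<partial>P x\<bar> \<le> (B * C2) * D * v x"
      using r B_nonneg constants_nonneg by (intro mean_dominated R_bound) auto
    ultimately show ?thesis unfolding eq by (simp add: ac_simps)
  qed
  have eq: "\<bar>moment 3 T x\<bar> = 3 * \<bar>LBINT r:{0..T}. ?m r\<bar>"
    using moment_Suc[of 2 T x] by (simp add: numeral_3_eq_3 numeral_2_eq_2 abs_mult)
  have "\<bar>LBINT r:{0..T}. ?m r\<bar> \<le> (LBINT r:{0..T}. (\<bar>\<sigma>2\<bar> * T * B * d * v x) * exp (- \<alpha> * r) + B * C2 * D * v x)"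
    using exp_decay_integral_Icc(1)[OF \<alpha>_pos, of T] by (intro abs_set_integral_le) (auto intro!: step[simplified])
  also have "\<dots> = (\<bar>\<sigma>2\<bar> * T * B * d * v x) * (LBINT r:{0..T}. exp (- \<alpha> * r)) + T * (B * C2 * D * v x)"
    using exp_decay_integral_Icc(1)[OF \<alpha>_pos, of T] T
    by (subst set_integral_add) (auto simp: set_integral_const measure_def)
  also have "\<dots> \<le> (\<bar>\<sigma>2\<bar> * T * B * d * v x) * (1 / \<alpha>) + T * (B * C2 * D * v x)"
    using exp_decay_integral_Icc(2)[OF \<alpha>_pos, of T] B_nonneg d_nonneg T v_nonneg[of x]
    by (intro add_right_mono mult_left_mono) auto
  also have "\<dots> = (\<bar>\<sigma>2\<bar> * B * d / \<alpha> + B * C2 * D) * T * v x" by (simp add: algebra_simps add_divide_distrib)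
  finally show ?thesis unfolding eq C3_def mult.assoc by (rule mult_left_mono) simp
qed

lemma moment_4_bound:
  assumes T: "0 \<le> T"
  shows "\<bar>moment 4 T x\<bar> \<le> C4 * T\<^sup>2 * v x"
proof -
  let ?m = "\<lambda>r. \<integral>\<omega>. h (Xp r \<omega>) * moment 3 (T - r) (Xp r \<omega>) \<partial>P x"
  have step: "\<bar>?m r\<bar> \<le> (B * (C3 * T)) * D * v x" if r: "r \<in> {0..T}" for r
  proof (rule mean_dominated)
    fix y
    have "\<bar>moment 3 (T - r) y\<bar> \<le> C3 * (T - r) * v y" using r by (intro moment_3_bound) auto
    also have "\<dots> \<le> (C3 * T) * v y"
      using r constants_nonneg v_nonneg[of y] by (intro mult_right_mono mult_left_mono) auto
    finally show "\<bar>h y * moment 3 (T - r) y\<bar> \<le> (B * (C3 * T)) * v y"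
      unfolding abs_mult using B_nonneg by (auto simp only: mult.assoc abs_ge_zero intro!: mult_mono h_bound)
  qed (use r T B_nonneg constants_nonneg in auto)
  have eq: "\<bar>moment 4 T x\<bar> = 4 * \<bar>LBINT r:{0..T}. ?m r\<bar>"
    using moment_Suc[of 3 T x] by (simp add: abs_mult)
  have "\<bar>LBINT r:{0..T}. ?m r\<bar> \<le> (LBINT r:{0..T}. (B * (C3 * T)) * D * v x)"
    by (intro abs_set_integral_le) (auto intro!: step[simplified])
  also have "\<dots> = B * C3 * D * T\<^sup>2 * v x"
    using T by (simp add: set_integral_const measure_def power2_eq_square)
  finally show ?thesis unfolding eq by (simp add: C4_def)
qed

end

section \<open>Mixing a Poisson law over the random clock\<close>

context ergodic_functional
begin

lemma integrable_occ_power [simp]: "integrable (P x) (\<lambda>\<omega>. occ s T \<omega> ^ n)"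
proof (rule integrable_P_bounded)
  show "\<bar>occ s T \<omega> ^ n\<bar> \<le> (B * \<bar>T - s\<bar>) ^ n" if "\<omega> \<in> space M" for \<omega>
    using occ_bound[OF that, of s T] unfolding power_abs by (intro power_mono) auto
qed measurable

text \<open>
  The third order Taylor estimate, integrated, with the cubic term split by \<open>abs_power3_le\<close> for
  \<open>\<delta> = \<epsilon>\<^sup>1\<^sup>/\<^sup>2\<close>.
\<close>
lemma mixed_poisson_remainder:
  assumes m: "0 < m" and \<epsilon>: "0 < \<epsilon>"
    and nonneg: "\<And>\<omega>. \<omega> \<in> space M \<Longrightarrow> 0 \<le> m + \<epsilon> * occ 0 T \<omega>"
  shows "\<bar>(\<integral>\<omega>. poisson_prob (m + \<epsilon> * occ 0 T \<omega>) k \<partial>P x)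
      - (poisson_prob m k + poisson_deriv 1 k m * \<epsilon> * moment 1 T x + poisson_deriv 2 k m / 2 * \<epsilon>\<^sup>2 * moment 2 T x)\<bar>
    \<le> 2 / 3 * (sqrt \<epsilon> * \<epsilon>\<^sup>2 * moment 2 T x + \<epsilon> ^ 4 / sqrt \<epsilon> * moment 4 T x)"
proof -
  interpret prob_space "P x" by (rule prob_space_P)
  let ?a = "\<lambda>\<omega>. poisson_prob (m + \<epsilon> * occ 0 T \<omega>) k"
  let ?b = "\<lambda>\<omega>. poisson_prob m k + poisson_deriv 1 k m * \<epsilon> * occ 0 T \<omega> ^ 1 + poisson_deriv 2 k m / 2 * \<epsilon>\<^sup>2 * occ 0 T \<omega> ^ 2"
  let ?c = "\<lambda>\<omega>. 2 / 3 * (sqrt \<epsilon> * \<epsilon>\<^sup>2 * occ 0 T \<omega> ^ 2 + \<epsilon> ^ 4 / sqrt \<epsilon> * occ 0 T \<omega> ^ 4)"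
  have a: "integrable (P x) ?a"
    by (rule integrable_P_bounded[where C = 1]) (use nonneg poisson_prob_le_1 in \<open>auto simp: abs_le_iff intro: order_trans[of _ 0]\<close>)
  have b: "integrable (P x) ?b" "integrable (P x) ?c"
    by (intro Bochner_Integration.integrable_add integrable_mult_right integrable_occ_power integrable_const)+
  have eb: "(\<integral>\<omega>. ?b \<omega> \<partial>P x) = poisson_prob m k + poisson_deriv 1 k m * \<epsilon> * moment 1 T x + poisson_deriv 2 k m / 2 * \<epsilon>\<^sup>2 * moment 2 T x"
    using prob_space unfolding moment_def by (simp add: integrable_occ_power[of _ _ _ 1, simplified] del: poisson_deriv.simps One_nat_def)
  have ec: "(\<integral>\<omega>. ?c \<omega> \<partial>P x) = 2 / 3 * (sqrt \<epsilon> * \<epsilon>\<^sup>2 * moment 2 T x + \<epsilon> ^ 4 / sqrt \<epsilon> * moment 4 T x)"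
    unfolding moment_def by simp
  have "\<bar>(\<integral>\<omega>. ?a \<omega> \<partial>P x) - (\<integral>\<omega>. ?b \<omega> \<partial>P x)\<bar> = \<bar>\<integral>\<omega>. ?a \<omega> - ?b \<omega> \<partial>P x\<bar>"
    by (simp only: Bochner_Integration.integral_diff[OF a b(1)])
  also have "\<dots> \<le> (\<integral>\<omega>. \<bar>?a \<omega> - ?b \<omega>\<bar> \<partial>P x)" by (rule integral_abs_bound)
  also have "\<dots> \<le> (\<integral>\<omega>. ?c \<omega> \<partial>P x)"
  proof (rule integral_mono)
    fix \<omega> assume "\<omega> \<in> space (P x)"
    then have "\<bar>?a \<omega> - ?b \<omega>\<bar> \<le> 4 / 3 * \<bar>\<epsilon> * occ 0 T \<omega>\<bar> ^ 3"
      using poisson_prob_taylor[OF m nonneg, of \<omega> k] by (simp add: power_mult_distrib mult.assoc del: poisson_deriv.simps)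
    also have "\<dots> \<le> 4 / 3 * ((sqrt \<epsilon> * (\<epsilon> * occ 0 T \<omega>)\<^sup>2 + (\<epsilon> * occ 0 T \<omega>) ^ 4 / sqrt \<epsilon>) / 2)"
      using \<epsilon> by (intro mult_left_mono abs_power3_le) auto
    also have "\<dots> = ?c \<omega>" by (simp add: power_mult_distrib)
    finally show "\<bar>?a \<omega> - ?b \<omega>\<bar> \<le> ?c \<omega>" .
  qed (intro integrable_abs Bochner_Integration.integrable_diff a b)+
  finally show ?thesis unfolding eb ec .
qed

text \<open>
  The error divided by \<open>\<epsilon>\<close> is bounded by the function \<open>G\<close> of the proof. Its three summands come from the Taylor
  remainder, from \<open>E Z - g\<close> and from \<open>E Z\<^sup>2 - \<sigma>\<^sup>2 T\<close>.
\<close>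
lemma mixed_poisson_expansion:
  assumes m: "0 < m" and t: "0 < t"
    and nonneg: "\<And>\<epsilon> \<omega>. 0 < \<epsilon> \<Longrightarrow> \<omega> \<in> space M \<Longrightarrow> 0 \<le> m + \<epsilon> * occ 0 (t / \<epsilon>) \<omega>"
  shows "(\<lambda>\<epsilon>. (\<integral>\<omega>. poisson_prob (m + \<epsilon> * occ 0 (t / \<epsilon>) \<omega>) k \<partial>P x)
      - (poisson_prob m k + \<epsilon> * (poisson_deriv 1 k m * g x + poisson_deriv 2 k m / 2 * \<sigma>2 * t))) \<in> o[at_right 0](\<lambda>\<epsilon>. \<epsilon>)"
    (is "?\<Delta> \<in> _")
proof -
  define p1 where "p1 = poisson_deriv 1 k m"
  define p2 where "p2 = poisson_deriv 2 k m"
  define V where "V = v x"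
  have V: "0 \<le> V" using v_nonneg[of x] by (simp add: V_def)
  define G where "G = (\<lambda>\<epsilon>. 2 / 3 * (sqrt \<epsilon> * (\<bar>\<sigma>2\<bar> * t + \<epsilon> * (C2 * V) + t\<^sup>2 * C4 * V))
    + \<bar>p1\<bar> * (C1 * V * (\<epsilon> / (\<alpha> * t))) + \<bar>p2\<bar> / 2 * (\<epsilon> * (C2 * V)))"
  have G: "(G \<longlongrightarrow> 0) (at_right 0)"
    unfolding G_def using \<alpha>_pos t by (auto intro!: tendsto_eq_intros)
  have bound: "\<bar>?\<Delta> \<epsilon>\<bar> \<le> \<epsilon> * G \<epsilon>" if \<epsilon>: "0 < \<epsilon>" for \<epsilon>
  proof -
    define T where "T = t / \<epsilon>"
    have T: "0 < T" "\<epsilon> * T = t" using t \<epsilon> by (auto simp: T_def)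
    define a1 a2 a4 where "a1 = moment 1 T x" and "a2 = moment 2 T x" and "a4 = moment 4 T x"
    have 1: "\<bar>(\<integral>\<omega>. poisson_prob (m + \<epsilon> * occ 0 T \<omega>) k \<partial>P x) - (poisson_prob m k + p1 * \<epsilon> * a1 + p2 / 2 * \<epsilon>\<^sup>2 * a2)\<bar>
      \<le> 2 / 3 * (sqrt \<epsilon> * \<epsilon>\<^sup>2 * a2 + \<epsilon> ^ 4 / sqrt \<epsilon> * a4)"
      unfolding p1_def p2_def a1_def a2_def a4_def
      by (rule mixed_poisson_remainder) (use m \<epsilon> nonneg in \<open>auto simp: T_def\<close>)
    have a2: "\<bar>a2 - \<sigma>2 * T\<bar> \<le> C2 * V"
      unfolding a2_def V_def using T by (intro moment_2_expansion) simp
    have "\<epsilon>\<^sup>2 * a2 \<le> \<epsilon>\<^sup>2 * (\<bar>\<sigma>2\<bar> * T + C2 * V)"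
    proof (rule mult_left_mono)
      have "\<sigma>2 * T \<le> \<bar>\<sigma>2\<bar> * T" using T by (intro mult_right_mono) auto
      then show "a2 \<le> \<bar>\<sigma>2\<bar> * T + C2 * V" using a2 by linarith
    qed simp
    also have "\<dots> = \<epsilon> * (\<bar>\<sigma>2\<bar> * t + \<epsilon> * (C2 * V))"
      unfolding T(2)[symmetric] by (simp add: algebra_simps power2_eq_square)
    finally have A2: "sqrt \<epsilon> * \<epsilon>\<^sup>2 * a2 \<le> sqrt \<epsilon> * (\<epsilon> * (\<bar>\<sigma>2\<bar> * t + \<epsilon> * (C2 * V)))"
      using \<epsilon> unfolding mult.assoc by (intro mult_left_mono) auto
    have "a4 \<le> C4 * T\<^sup>2 * V" using moment_4_bound[of T x] T unfolding a4_def V_def by simp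
    then have "\<epsilon> ^ 4 / sqrt \<epsilon> * a4 \<le> \<epsilon> ^ 4 / sqrt \<epsilon> * (C4 * T\<^sup>2 * V)"
      using \<epsilon> by (intro mult_left_mono) auto
    also have "\<dots> = sqrt \<epsilon> * (\<epsilon> * (t\<^sup>2 * C4 * V))"
    proof -
      have "\<epsilon> = sqrt \<epsilon> * sqrt \<epsilon>" using \<epsilon> by simp
      then have "\<epsilon> / sqrt \<epsilon> = sqrt \<epsilon>" using \<epsilon> by (metis nonzero_mult_div_cancel_left real_sqrt_eq_zero_cancel_iff less_irrefl)
      moreover have "\<epsilon> ^ 4 / sqrt \<epsilon> * (C4 * T\<^sup>2 * V) = (\<epsilon> / sqrt \<epsilon>) * (\<epsilon> * ((\<epsilon> * T)\<^sup>2 * C4 * V))"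
        by (simp add: power2_eq_square power4_eq_xxxx)
      ultimately show ?thesis using T(2) by simp
    qed
    finally have A4: "\<epsilon> ^ 4 / sqrt \<epsilon> * a4 \<le> sqrt \<epsilon> * (\<epsilon> * (t\<^sup>2 * C4 * V))" .
    have A1: "\<bar>p1 * (\<epsilon> * (a1 - g x))\<bar> \<le> \<bar>p1\<bar> * (\<epsilon> * (C1 * V * (\<epsilon> / (\<alpha> * t))))"
    proof -
      \<comment> \<open>A polynomial bound on the exponential error suffices and keeps \<open>G\<close> elementary.\<close>
      have "\<alpha> * T \<le> exp (\<alpha> * T)" using exp_ge_add_one_self[of "\<alpha> * T"] by linarith
      then have "inverse (exp (\<alpha> * T)) \<le> inverse (\<alpha> * T)" using T \<alpha>_pos by (intro le_imp_inverse_le) auto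
      then have "exp (- \<alpha> * T) \<le> \<epsilon> / (\<alpha> * t)" by (simp add: exp_minus T_def inverse_eq_divide)
      then have "C1 * V * exp (- \<alpha> * T) \<le> C1 * V * (\<epsilon> / (\<alpha> * t))"
        using constants_nonneg V by (intro mult_left_mono) auto
      moreover have "\<bar>a1 - g x\<bar> \<le> C1 * V * exp (- \<alpha> * T)"
        unfolding a1_def V_def using T by (intro moment_1_limit) simp
      ultimately have "\<bar>a1 - g x\<bar> \<le> C1 * V * (\<epsilon> / (\<alpha> * t))" by linarith
      moreover have "\<bar>p1 * (\<epsilon> * (a1 - g x))\<bar> = \<bar>p1\<bar> * (\<epsilon> * \<bar>a1 - g x\<bar>)" using \<epsilon> by (simp add: abs_mult)
      ultimately show ?thesis using \<epsilon> by (simp only:) (intro mult_left_mono, auto)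
    qed
    have B2: "\<bar>p2 / 2 * (\<epsilon>\<^sup>2 * (a2 - \<sigma>2 * T))\<bar> \<le> \<bar>p2\<bar> / 2 * (\<epsilon>\<^sup>2 * (C2 * V))"
      using a2 unfolding abs_mult by (auto intro!: mult_left_mono)
    have eq: "?\<Delta> \<epsilon> = ((\<integral>\<omega>. poisson_prob (m + \<epsilon> * occ 0 T \<omega>) k \<partial>P x) - (poisson_prob m k + p1 * \<epsilon> * a1 + p2 / 2 * \<epsilon>\<^sup>2 * a2))
      + p1 * (\<epsilon> * (a1 - g x)) + p2 / 2 * (\<epsilon>\<^sup>2 * (a2 - \<sigma>2 * T))"
      unfolding p1_def[symmetric] p2_def[symmetric] T_def[symmetric]
      by (subst T(2)[symmetric]) (simp add: algebra_simps power2_eq_square)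
    have tri: "\<bar>a + b + c\<bar> \<le> a' + b' + c'" if "\<bar>a\<bar> \<le> a'" "\<bar>b\<bar> \<le> b'" "\<bar>c\<bar> \<le> c'" for a b c a' b' c' :: real
      using that by linarith
    have "\<bar>?\<Delta> \<epsilon>\<bar> \<le> 2 / 3 * (sqrt \<epsilon> * (\<epsilon> * (\<bar>\<sigma>2\<bar> * t + \<epsilon> * (C2 * V))) + sqrt \<epsilon> * (\<epsilon> * (t\<^sup>2 * C4 * V)))
      + \<bar>p1\<bar> * (\<epsilon> * (C1 * V * (\<epsilon> / (\<alpha> * t)))) + \<bar>p2\<bar> / 2 * (\<epsilon>\<^sup>2 * (C2 * V))"
      unfolding eq by (rule tri[OF order_trans[OF 1 mult_left_mono[OF add_mono[OF A2 A4]]] A1 B2]) simp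
    also have "\<dots> = \<epsilon> * G \<epsilon>" unfolding G_def by (simp add: algebra_simps power2_eq_square)
    finally show ?thesis .
  qed
  show ?thesis
  proof (rule smalloI_tendsto)
    show "((\<lambda>\<epsilon>. ?\<Delta> \<epsilon> / \<epsilon>) \<longlongrightarrow> 0) (at_right 0)"
    proof (rule Lim_null_comparison[OF _ G])
      show "\<forall>\<^sub>F \<epsilon> in at_right 0. norm (?\<Delta> \<epsilon> / \<epsilon>) \<le> G \<epsilon>"
        using eventually_at_right_less[of "0 :: real"]
      proof eventually_elim
        case (elim \<epsilon>)
        then show ?case using bound[of \<epsilon>] by (simp only: real_norm_def abs_divide abs_of_pos divide_le_eq mult.commute if_True)
      qed
    qed
    show "\<forall>\<^sub>F \<epsilon> in at_right 0. \<epsilon> \<noteq> (0 :: real)"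
      using eventually_at_right_less[of "0 :: real"] by eventually_elim simp
  qed
qed
end

section \<open>The expansion for doubly stochastic Poisson processes\<close>

text \<open>
  Taking expectations in the defining property for the single interval \<open>[0, t]\<close>.
\<close>
lemma doubly_stochastic_count_prob:
  assumes dsp: "doubly_stochastic_poisson_process \<mu> G l N" and sub: "subalgebra \<mu> G" and t: "0 \<le> t"
    and [measurable]: "(\<lambda>\<omega>. LBINT s:{0..t}. l s \<omega>) \<in> borel_measurable \<mu>"
  shows "\<P>(\<omega> in \<mu>. N t \<omega> = k) = (\<integral>\<omega>. poisson_prob (LBINT s:{0..t}. l s \<omega>) k \<partial>\<mu>)"
proof -
  interpret prob_space \<mu> using dsp by (simp add: doubly_stochastic_poisson_process_def)
  interpret fs: finite_measure_subalgebra \<mu> G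
    by unfold_locales (rule sub)
  have cp: "counting_process \<mu> N" using dsp by (simp add: doubly_stochastic_poisson_process_def)
  then have [measurable]: "N t \<in> \<mu> \<rightarrow>\<^sub>M count_space UNIV" using t by (simp add: counting_process_def)
  define I where "I = (indicator {\<omega> \<in> space \<mu>. N t \<omega> = k} :: _ \<Rightarrow> real)"
  have [measurable]: "I \<in> borel_measurable \<mu>" unfolding I_def by measurable
  have intI: "integrable \<mu> I"
    by (rule integrable_const_bound[where B = 1]) (auto simp: I_def split: split_indicator)
  define \<tau> where "\<tau> = (\<lambda>i::nat. if i = 0 then 0 else t)"
  have "mono \<tau>" using t by (auto simp: \<tau>_def mono_def)
  moreover have "{\<omega>' \<in> space \<mu>. \<forall>i<1. N (\<tau> (Suc i)) \<omega>' - N (\<tau> i) \<omega>' = k} = {\<omega> \<in> space \<mu>. N t \<omega> = k}"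
    using cp by (auto simp: \<tau>_def counting_process_def)
  moreover have "0 \<le> \<tau> 0 \<and> mono \<tau> \<longrightarrow>
      (AE \<omega> in \<mu>. real_cond_exp \<mu> G
          (indicator {\<omega>' \<in> space \<mu>. \<forall>i<1. N (\<tau> (Suc i)) \<omega>' - N (\<tau> i) \<omega>' = k}) \<omega>
        = (\<Prod>i<1. poisson_prob (LBINT s:{\<tau> i..\<tau> (Suc i)}. l s \<omega>) k))"
    using dsp[unfolded doubly_stochastic_poisson_process_def, THEN conjunct2, THEN conjunct2, rule_format, of \<tau> 1 "\<lambda>_. k"] by blast
  ultimately have ae: "AE \<omega> in \<mu>. real_cond_exp \<mu> G I \<omega> = poisson_prob (LBINT s:{0..t}. l s \<omega>) k"
    by (simp add: \<tau>_def I_def)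
  have "\<P>(\<omega> in \<mu>. N t \<omega> = k) = (\<integral>\<omega>. I \<omega> \<partial>\<mu>)"
    unfolding I_def by simp
  also have "\<dots> = (\<integral>\<omega>. real_cond_exp \<mu> G I \<omega> \<partial>\<mu>)"
    by (rule fs.real_cond_exp_int(2)[OF intI, symmetric])
  also have "\<dots> = (\<integral>\<omega>. poisson_prob (LBINT s:{0..t}. l s \<omega>) k \<partial>\<mu>)"
    by (rule integral_cong_AE[OF _ _ ae]) (auto simp: measurable_from_subalg[OF sub])
  finally show ?thesis .
qed

lemma poisson_process_count_prob:
  assumes "poisson_process R r N" "0 \<le> t"
  shows "\<P>(\<omega> in R. N t \<omega> = k) = poisson_prob (r * t) k"
proof -
  have "{\<omega> \<in> space R. N t \<omega> - N 0 \<omega> = k} = {\<omega> \<in> space R. N t \<omega> = k}"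
    using assms by (auto simp: poisson_process_def counting_process_def)
  moreover have "\<forall>s t k. 0 \<le> s \<and> s \<le> t \<longrightarrow> \<P>(\<omega> in R. N t \<omega> - N s \<omega> = k) = poisson_prob (r * (t - s)) k"
    using assms(1) unfolding poisson_process_def by (elim conjE)
  from this[rule_format, of 0 t k] have "\<P>(\<omega> in R. N t \<omega> - N 0 \<omega> = k) = poisson_prob (r * t) k"
    using assms(2) by simp
  ultimately show ?thesis by simp
qed

text \<open>
  The constant \<open>d\<close> is nonnegative because the supremum includes \<open>h = 0\<close> and \<open>v\<close> is positive.
\<close>
lemma geometrically_ergodic_mixing:
  assumes erg: "geometrically_ergodic P X v \<pi>"
  shows "\<exists>d \<alpha>. 0 \<le> d \<and> 0 < \<alpha> \<and> (\<forall>h x t. h \<in> borel_measurable borel \<longrightarrow> (\<forall>y. \<bar>h y\<bar> \<le> v y) \<longrightarrow> 0 \<le> t \<longrightarrow>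
      \<bar>(\<integral>\<omega>. h (X t \<omega>) \<partial>P x) - (\<integral>y. h y \<partial>\<pi>)\<bar> \<le> d * v x * exp (- \<alpha> * t))"
proof -
  from erg obtain d \<alpha> where \<alpha>: "0 < \<alpha>" and sup: "\<And>x t. 0 \<le> t \<Longrightarrow>
      (SUP h \<in> {h \<in> borel_measurable borel. \<forall>y. \<bar>h y\<bar> \<le> v y}.
          ereal \<bar>(\<integral>\<omega>. h (X t \<omega>) \<partial>P x) - (\<integral>y. h y \<partial>\<pi>)\<bar>) \<le> ereal (d * v x * exp (- \<alpha> * t))"
    unfolding geometrically_ergodic_def by blast
  have v: "1 \<le> v y" for y using erg by (simp add: geometrically_ergodic_def)
  have *: "\<bar>(\<integral>\<omega>. h (X t \<omega>) \<partial>P x) - (\<integral>y. h y \<partial>\<pi>)\<bar> \<le> d * v x * exp (- \<alpha> * t)"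
    if "h \<in> borel_measurable borel" "\<And>y. \<bar>h y\<bar> \<le> v y" "0 \<le> t" for h x t
  proof -
    have "ereal \<bar>(\<integral>\<omega>. h (X t \<omega>) \<partial>P x) - (\<integral>y. h y \<partial>\<pi>)\<bar> \<le> ereal (d * v x * exp (- \<alpha> * t))"
      by (rule order_trans[OF SUP_upper sup]) (use that in auto)
    then show ?thesis by simp
  qed
  have "0 \<le> d * v undefined"
    using *[of "\<lambda>_. 0" 0 undefined] v order_trans[OF zero_le_one v] by simp
  then have "0 \<le> d" using v[of undefined] by (simp add: zero_le_mult_iff)
  then show ?thesis using \<alpha> by (intro exI[of _ d] exI[of _ \<alpha>] conjI allI impI *) auto
qed

theorem theorem3:
  fixes M :: "'w measure"
    and P :: "'s::polish_space \<Rightarrow> 'w measure"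
    and X :: "real \<Rightarrow> 'w \<Rightarrow> 's"
    and v :: "'s \<Rightarrow> real"
    and \<pi> :: "'s measure"
    and f :: "'s \<Rightarrow> real"
    and Q :: "'q measure"
    and Xinf :: "'q \<Rightarrow> 's"
    and N :: "real \<Rightarrow> real \<Rightarrow> 'w \<Rightarrow> nat"
    and R :: "'r measure"
    and N0 :: "real \<Rightarrow> 'r \<Rightarrow> nat"
    and lam \<sigma>2 :: real
    and fc g :: "'s \<Rightarrow> real"
    and x :: 's
    and t :: real
    and k :: nat
  assumes markov: "markov_process M P X"
    and ergodic: "geometrically_ergodic P X v \<pi>"
    and f_nonneg: "\<And>y. 0 \<le> f y"
    and f_bounded: "bounded (range f)"
    and f_continuous: "continuous_on UNIV f"
    and Q: "prob_space Q"
    and Xinf: "Xinf \<in> Q \<rightarrow>\<^sub>M borel" "distr Q borel Xinf = \<pi>"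
    and lam: "lam = (\<integral>\<omega>. f (Xinf \<omega>) \<partial>Q)"
    and lam_pos: "0 < lam"
    and N: "\<And>\<epsilon> y. 0 < \<epsilon> \<Longrightarrow>
      doubly_stochastic_poisson_process (P y) (process_sigma M {0..} X)
        (\<lambda>s \<omega>. f (X (s / \<epsilon>) \<omega>)) (N \<epsilon>)"
    and N0: "poisson_process R lam N0"
    and fc: "fc = (\<lambda>y. f y - (\<integral>\<omega>. f (Xinf \<omega>) \<partial>Q))"
    and g: "g = (\<lambda>y. LBINT s:{0..}. (\<integral>\<omega>. fc (X s \<omega>) \<partial>P y))"
    and \<sigma>2: "\<sigma>2 = 2 * (\<integral>\<omega>. fc (Xinf \<omega>) * g (Xinf \<omega>) \<partial>Q)"
    and t: "0 < t"
  shows "(\<lambda>\<epsilon>. \<P>(\<omega> in P x. N \<epsilon> t \<omega> = k)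
      - (\<P>(\<omega> in R. N0 t \<omega> = k)
         + \<epsilon> * \<P>(\<omega> in R. N0 t \<omega> = k)
           * ((real k / (lam * t) - 1) * g x
              + 1 / 2 * (1 - 2 * real k / (lam * t)
                         + real k * (real k - 1) / (lam * t)\<^sup>2) * \<sigma>2 * t)))
    \<in> o[at_right 0](\<lambda>\<epsilon>. \<epsilon>)"
proof -
  from f_bounded obtain B0 where B0: "\<And>y. \<bar>f y\<bar> \<le> B0" by (auto simp: bounded_iff)
  have f_meas[measurable]: "f \<in> borel_measurable borel"
    using f_continuous by (rule borel_measurable_continuous_onI)
  note [measurable] = Xinf(1)
  have fc_lam: "fc = (\<lambda>y. f y - lam)" unfolding fc lam ..
  have prob_\<pi>: "prob_space \<pi>" and sets_\<pi>: "sets \<pi> = sets borel"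
    using ergodic by (auto simp: geometrically_ergodic_def)
  have lam_\<pi>: "lam = (\<integral>y. f y \<partial>\<pi>)"
    unfolding lam Xinf(2)[symmetric] by (simp add: integral_distr)
  obtain d \<alpha> where d\<alpha>: "0 \<le> d" "0 < \<alpha>" and
    mix: "\<forall>h x t. h \<in> borel_measurable borel \<longrightarrow> (\<forall>y. \<bar>h y\<bar> \<le> v y) \<longrightarrow> 0 \<le> t \<longrightarrow>
      \<bar>(\<integral>\<omega>. h (X t \<omega>) \<partial>P x) - (\<integral>y. h y \<partial>\<pi>)\<bar> \<le> d * v x * exp (- \<alpha> * t)"
    using geometrically_ergodic_mixing[OF ergodic] by (elim exE conjE)
  interpret markov M P X by (rule markov.intro) (rule markov)
  interpret E: ergodic_functional M P X fc "B0 + \<bar>lam\<bar>" v \<pi> d \<alpha>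
  proof (intro ergodic_functional.intro markov_functional.intro
      markov_functional_axioms.intro ergodic_functional_axioms.intro)
    interpret \<pi>: prob_space \<pi> by (rule prob_\<pi>)
    have "integrable \<pi> f"
      by (rule \<pi>.integrable_const_bound[where B = B0]) (use B0 sets_\<pi> in \<open>auto cong: measurable_cong_sets\<close>)
    then show "(\<integral>y. fc y \<partial>\<pi>) = 0"
      unfolding fc_lam using lam_\<pi> by (simp add: \<pi>.prob_space)
    show "fc \<in> borel_measurable borel" unfolding fc_lam by measurable
    show "\<bar>fc y\<bar> \<le> B0 + \<bar>lam\<bar>" for y unfolding fc_lam using B0[of y] by simp
    show "\<bar>(\<integral>\<omega>. h (Xp t \<omega>) \<partial>P x) - (\<integral>y. h y \<partial>\<pi>)\<bar> \<le> d * v x * exp (- \<alpha> * t)"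
      if "h \<in> borel_measurable borel" "\<And>y. \<bar>h y\<bar> \<le> v y" "0 \<le> t" for h x t
      using mix that by (simp add: Xp_nonneg)
  qed (use ergodic d\<alpha> in \<open>simp_all add: geometrically_ergodic_def Xp_nonneg markov_axioms\<close>)
  have g_eq: "g = E.g"
    unfolding g E.g_def by (intro ext set_lebesgue_integral_cong) (auto simp: Xp_nonneg)
  have \<sigma>2_eq: "\<sigma>2 = E.\<sigma>2"
    unfolding \<sigma>2 E.\<sigma>2_def g_eq unfolding Xinf(2)[symmetric] by (subst integral_distr) auto
  define m where "m = lam * t"
  have m: "0 < m" using lam_pos t by (simp add: m_def)
  \<comment> \<open>The random clock \<open>A\<close>, in the time scale of \<open>X\<close>.\<close>
  have clock: "(LBINT s:{0..t}. f (X (s / \<epsilon>) \<omega>)) = m + \<epsilon> * E.occ 0 (t / \<epsilon>) \<omega>"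
    if \<epsilon>: "0 < \<epsilon>" and \<omega>: "\<omega> \<in> space M" for \<epsilon> \<omega>
  proof -
    note [measurable] = \<omega>
    have int: "set_integrable lborel {0..t / \<epsilon>} (\<lambda>r. f (Xp r \<omega>))"
      by (rule set_integrable_Icc_bounded[where C = B0]) (auto simp: B0)
    have "(LBINT s:{0..t}. f (X (s / \<epsilon>) \<omega>)) = (LBINT s:{0..t}. f (Xp (s / \<epsilon>) \<omega>))"
      using \<epsilon> by (intro set_lebesgue_integral_cong) (auto simp: Xp_nonneg)
    also have "\<dots> = \<epsilon> * (LBINT r:{0..t / \<epsilon>}. f (Xp r \<omega>))" by (rule set_integral_Icc_scale[OF \<epsilon>])
    also have "\<dots> = m + \<epsilon> * E.occ 0 (t / \<epsilon>) \<omega>"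
      unfolding E.occ_def unfolding fc_lam using int t \<epsilon>
      by (subst set_integral_diff) (auto simp: set_integral_const measure_def m_def field_simps)
    finally show ?thesis .
  qed
  have clock_meas: "(\<lambda>\<omega>. LBINT s:{0..t}. f (X (s / \<epsilon>) \<omega>)) \<in> borel_measurable (P x)" if "0 < \<epsilon>" for \<epsilon>
    by (subst measurable_cong[OF clock[OF that]]) (auto cong: measurable_cong_sets)
  have N_prob: "\<P>(\<omega> in P x. N \<epsilon> t \<omega> = k) = (\<integral>\<omega>. poisson_prob (m + \<epsilon> * E.occ 0 (t / \<epsilon>) \<omega>) k \<partial>P x)" if \<epsilon>: "0 < \<epsilon>" for \<epsilon>
  proof -
    have "\<P>(\<omega> in P x. N \<epsilon> t \<omega> = k) = (\<integral>\<omega>. poisson_prob (LBINT s:{0..t}. f (X (s / \<epsilon>) \<omega>)) k \<partial>P x)"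
      using t by (intro doubly_stochastic_count_prob[OF N[OF \<epsilon>] subalgebra_process_sigma] clock_meas[OF \<epsilon>]) auto
    also have "\<dots> = (\<integral>\<omega>. poisson_prob (m + \<epsilon> * E.occ 0 (t / \<epsilon>) \<omega>) k \<partial>P x)"
      by (intro Bochner_Integration.integral_cong) (simp_all add: clock[OF \<epsilon>])
    finally show ?thesis .
  qed
  have N0_prob: "\<P>(\<omega> in R. N0 t \<omega> = k) = poisson_prob m k"
    unfolding m_def using N0 t by (intro poisson_process_count_prob) auto
  have nonneg: "0 \<le> m + \<epsilon> * E.occ 0 (t / \<epsilon>) \<omega>" if "0 < \<epsilon>" "\<omega> \<in> space M" for \<epsilon> \<omega>
    unfolding clock[OF that, symmetric] set_lebesgue_integral_def
    by (intro integral_nonneg_AE) (auto simp: f_nonneg)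
  have "(\<lambda>\<epsilon>. (\<integral>\<omega>. poisson_prob (m + \<epsilon> * E.occ 0 (t / \<epsilon>) \<omega>) k \<partial>P x)
      - (poisson_prob m k + \<epsilon> * (poisson_deriv 1 k m * g x + poisson_deriv 2 k m / 2 * \<sigma>2 * t))) \<in> o[at_right 0](\<lambda>\<epsilon>. \<epsilon>)"
    unfolding g_eq \<sigma>2_eq by (rule E.mixed_poisson_expansion[OF m t nonneg])
  moreover have "\<forall>\<^sub>F \<epsilon> in at_right 0.
      (\<integral>\<omega>. poisson_prob (m + \<epsilon> * E.occ 0 (t / \<epsilon>) \<omega>) k \<partial>P x)
        - (poisson_prob m k + \<epsilon> * (poisson_deriv 1 k m * g x + poisson_deriv 2 k m / 2 * \<sigma>2 * t))
      = \<P>(\<omega> in P x. N \<epsilon> t \<omega> = k)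
      - (\<P>(\<omega> in R. N0 t \<omega> = k)
         + \<epsilon> * \<P>(\<omega> in R. N0 t \<omega> = k)
           * ((real k / (lam * t) - 1) * g x
              + 1 / 2 * (1 - 2 * real k / (lam * t)
                         + real k * (real k - 1) / (lam * t)\<^sup>2) * \<sigma>2 * t))"
    using eventually_at_right_less[of "0 :: real"]
  proof eventually_elim
    case (elim \<epsilon>)
    have "e * (p * a * G + p * b / 2 * S * u) = e * p * (a * G + 1 / 2 * b * S * u)" for e p a b G S u :: real
      by (simp add: algebra_simps)
    then show ?case
      unfolding N_prob[OF elim] N0_prob m_def[symmetric] poisson_deriv_1[OF m] poisson_deriv_2[OF m] by simp
  qed
  ultimately show ?thesis by (rule landau_o.small.in_cong[THEN iffD1, rotated])
qed

end
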